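(* Let $\widetilde{M}$ be an $(n+1)$-dimensional closed manifold equipped with a projective structure $[\nabla]$, a non-degenerate parallel symmetric tractor $H^{AB}$ of signature $(2,n)$ with pointwise inverse $\Phi_{AB}$, and a nowhere vanishing parallel tractor $I^A$ such that $\Phi_{AB}I^AI^B=0$. Put $n^a=Z^a_AI^A$, $\sigma=\Phi_{AB}I^AX^B$ and $\lambda=\Phi_{AB}X^AX^B$, and write $\mathcal{Z}(\cdot)$ for the zero set. 1. $\widetilde{M}=M\sqcup\mathcal{Z}(n)$, where $\mathcal{Z}(n)=\{x\in\widetilde M : n^a(x)=0\}$ is composed of finitely many isolated points and $M$ is its complement. 2. $M=\mathcal{O}\sqcup\Sigma$, where $\mathcal{O}=\{\sigma\neq 0\}$ is an open submanifold and $\Sigma:=\mathcal{Z}(\sigma)\setminus\mathcal{Z}(n)$, if non-empty, is a smooth embedded hypersurface. 3. $\Sigma=\Sigma^-\sqcup\Sigma^0\sqcup\Sigma^+$, where $\Sigma^-:=\mathcal{Z}(\sigma)\cap\{\lambda<0\}$, $\Sigma^+:=\mathcal{Z}(\sigma)\cap\{\lambda>0\}$ and $\Sigma^0:=(\mathcal{Z}(\sigma)\cap\mathcal{Z}(\lambda))\setminus\mathcal{Z}(n)$ are smooth submanifolds. In summary, $\widetilde{M}=\mathcal{O}\sqcup\Sigma^-\sqcup\Sigma^0\sqcup\Sigma^+\sqcup\mathcal{Z}(n)$.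
   Context: All affine connections are torsion-free. On a manifold of dimension $n+1$, $\nabla$ and $\hat\nabla$ are projectively equivalent, written $\hat\nabla=\nabla+\Upsilon$, if $\hat\nabla_a\xi^b=\nabla_a\xi^b+\Upsilon_a\xi^b+\Upsilon_c\xi^c\delta_a^b$ for some 1-form $\Upsilon_a$; a projective structure $[\nabla]$ is an equivalence class. $\mathcal{E}(w)$ is the real line bundle associated to the frame bundle by $A\mapsto|\det A|^{w/(n+2)}$ (so $\mathcal{E}(-(n+2))$ is the bundle of volume densities); its sections (densities of weight $w$) have a well-defined sign. $\mathcal{B}(w)=\mathcal{B}\otimes\mathcal{E}(w)$. A scale is a choice of $\nabla$ in the class; a nowhere vanishing weight 1 density $s$ determines a unique scale with $\nabla s=0$ (a special scale), whose Schouten tensor is $P_{ab}=\frac1n R_{ab}$, with $R_{ab}=R_{da}{}^{d}{}_{b}$ the Ricci tensor. The standard projective tractor bundle $\mathcal{T}$ has rank $n+2$, $\mathcal{T}^*=J^1\mathcal{E}(1)$, and fits in the exact sequence $0\to\mathcal{E}(-1)\xrightarrow{X^A}\mathcal{T}\xrightarrow{Z^a_A}TM(-1)\to0$. A scale splits it, so tractors are written $T^A=\xi^aW_a^A+\rho X^A$ with $\xi^a$ a weight $-1$ vector field and $\rho$ a weight $-1$ density; under $\hat\nabla=\nabla+\Upsilon$, $\widehat W^A_a=W^A_a+\Upsilon_aX^A$. The (normal) tractor connection is $\nabla_c(\xi^aW^A_a+\rho X^A)=(\nabla_c\xi^a+\rho\,\delta_c^a)W^A_a+(\nabla_c\rho-P_{ca}\xi^a)X^A$,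 and "parallel" refers to it. Signature $(q,p)$ means $q$ minus signs and $p$ plus signs. $n^a$ is a vector field of weight $-1$, and $\sigma,\lambda$ are densities of weight $1$ and $2$. *)

theory Defs
  imports "HOL-Analysis.Analysis"
begin

section \<open>Smooth maps and smooth manifolds\<close>

text \<open>Meant for open \<open>S\<close>: the Frechet derivatives are taken at \<open>x\<close>, not within \<open>S\<close>.\<close>

primrec ck_on :: "nat \<Rightarrow> 'a::real_normed_vector set \<Rightarrow> ('a \<Rightarrow> 'b::real_normed_vector) \<Rightarrow> bool" where
  "ck_on 0 S f \<longleftrightarrow> continuous_on S f"
| "ck_on (Suc k) S f \<longleftrightarrow> (\<forall>x\<in>S. f differentiable (at x)) \<and>
     (\<forall>v. ck_on k S (\<lambda>x. frechet_derivative f (at x) v))"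

definition smooth_on :: "'a::real_normed_vector set \<Rightarrow> ('a \<Rightarrow> 'b::real_normed_vector) \<Rightarrow> bool" where
  "smooth_on S f \<longleftrightarrow> (\<forall>k. ck_on k S f)"

definition partial :: "'m::finite \<Rightarrow> (real^'m \<Rightarrow> 'b::real_normed_vector) \<Rightarrow> real^'m \<Rightarrow> 'b" where
  "partial a f x = frechet_derivative f (at x) (axis a 1)"

text \<open>A chart is a domain together with a coordinate map; only the values of the map on the
  domain matter. The manifold is the whole type \<open>'p\<close>, its dimension is \<open>CARD('m)\<close>.\<close>

type_synonym ('p, 'm) chart = "'p set \<times> ('p \<Rightarrow> real^'m)"

abbreviation chart_dom :: "('p, 'm) chart \<Rightarrow> 'p set" where
  "chart_dom \<equiv> fst"

abbreviation coord :: "('p, 'm) chart \<Rightarrow> 'p \<Rightarrow> real^'m" where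
  "coord \<equiv> snd"

definition chart_image :: "('p, 'm) chart \<Rightarrow> (real^'m) set" where
  "chart_image c = coord c ` chart_dom c"

definition is_chart :: "('p::topological_space, 'm::finite) chart \<Rightarrow> bool" where
  "is_chart c \<longleftrightarrow> open (chart_dom c) \<and> open (chart_image c) \<and>
     (\<exists>g. homeomorphism (chart_dom c) (chart_image c) (coord c) g)"

definition overlap :: "('p, 'm) chart \<Rightarrow> ('p, 'm) chart \<Rightarrow> (real^'m) set" where
  "overlap c c' = coord c ` (chart_dom c \<inter> chart_dom c')"

definition transition :: "('p, 'm) chart \<Rightarrow> ('p, 'm) chart \<Rightarrow> real^'m \<Rightarrow> real^'m" where
  "transition c c' x = coord c' (inv_into (chart_dom c) (coord c) x)"

definition compatible :: "('p, 'm::finite) chart \<Rightarrow> ('p, 'm) chart \<Rightarrow> bool" where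
  "compatible c c' \<longleftrightarrow> smooth_on (overlap c c') (transition c c') \<and>
     smooth_on (overlap c' c) (transition c' c)"

definition smooth_atlas :: "('p::topological_space, 'm::finite) chart set \<Rightarrow> bool" where
  "smooth_atlas A \<longleftrightarrow> (\<forall>c\<in>A. is_chart c) \<and> (\<forall>c\<in>A. \<forall>c'\<in>A. compatible c c') \<and>
     (\<Union>c\<in>A. chart_dom c) = UNIV"

definition maximal_atlas :: "('p::topological_space, 'm::finite) chart set \<Rightarrow> ('p, 'm) chart set" where
  "maximal_atlas A = {c. is_chart c \<and> (\<forall>c'\<in>A. compatible c c')}"

text \<open>\<open>jacobian c c' x $ i $ j\<close> is the derivative of the \<open>i\<close>-th coordinate of \<open>c'\<close> in the direction
  of the \<open>j\<close>-th coordinate of \<open>c\<close>.\<close>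

definition jacobian :: "('p, 'm::finite) chart \<Rightarrow> ('p, 'm) chart \<Rightarrow> real^'m \<Rightarrow> real^'m^'m" where
  "jacobian c c' x = matrix (frechet_derivative (transition c c') (at x))"

definition embedded_submanifold ::
  "('p::topological_space, 'm::finite) chart set \<Rightarrow> nat \<Rightarrow> 'p set \<Rightarrow> bool" where
  "embedded_submanifold A k S \<longleftrightarrow>
     (\<forall>p\<in>S. \<exists>c\<in>maximal_atlas A. \<exists>K. p \<in> chart_dom c \<and> card K = k \<and>
        coord c ` (chart_dom c \<inter> S) = chart_image c \<inter> {x. \<forall>i. i \<notin> K \<longrightarrow> x $ i = 0})"

definition smooth_submanifold :: "('p::topological_space, 'm::finite) chart set \<Rightarrow> 'p set \<Rightarrow> bool" where
  "smooth_submanifold A S \<longleftrightarrow> (\<exists>k. embedded_submanifold A k S)"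

definition embedded_hypersurface :: "('p::topological_space, 'm::finite) chart set \<Rightarrow> 'p set \<Rightarrow> bool" where
  "embedded_hypersurface A S \<longleftrightarrow> embedded_submanifold A (CARD('m) - 1) S"


section \<open>Connections and projective structures\<close>

text \<open>Geometric objects are given by their components in the charts of an atlas, as functions of the
  coordinates, subject to the transformation laws; values outside the image of a chart are
  irrelevant. A connection is given by \<open>\<Gamma> c x a b e\<close>, the Christoffel symbol with lower indices
  \<open>a\<close> (direction of differentiation) and \<open>b\<close>, and upper index \<open>e\<close>.\<close>

type_synonym 'm local_connection = "real^'m \<Rightarrow> 'm \<Rightarrow> 'm \<Rightarrow> 'm \<Rightarrow> real"
type_synonym ('p, 'm) connection = "('p, 'm) chart \<Rightarrow> 'm local_connection"
type_synonym ('p, 'm) covector_field = "('p, 'm) chart \<Rightarrow> real^'m \<Rightarrow> real^'m"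

definition affine_connection :: "('p, 'm::finite) chart set \<Rightarrow> ('p, 'm) connection \<Rightarrow> bool" where
  "affine_connection A \<Gamma> \<longleftrightarrow>
     (\<forall>c\<in>A. \<forall>a b e. smooth_on (chart_image c) (\<lambda>x. \<Gamma> c x a b e)) \<and>
     (\<forall>c\<in>A. \<forall>c'\<in>A. \<forall>x\<in>overlap c c'. \<forall>a b e.
        (\<Sum>d\<in>UNIV. jacobian c c' x $ e $ d * \<Gamma> c x a b d) =
        (\<Sum>i\<in>UNIV. \<Sum>j\<in>UNIV. jacobian c c' x $ i $ a * jacobian c c' x $ j $ b *
            \<Gamma> c' (transition c c' x) i j e)
        + partial a (\<lambda>y. jacobian c c' y $ e $ b) x)"

definition torsion_free :: "('p, 'm::finite) chart set \<Rightarrow> ('p, 'm) connection \<Rightarrow> bool" where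
  "torsion_free A \<Gamma> \<longleftrightarrow> (\<forall>c\<in>A. \<forall>x\<in>chart_image c. \<forall>a b e. \<Gamma> c x a b e = \<Gamma> c x b a e)"

definition one_form :: "('p, 'm::finite) chart set \<Rightarrow> ('p, 'm) covector_field \<Rightarrow> bool" where
  "one_form A \<Upsilon> \<longleftrightarrow>
     (\<forall>c\<in>A. smooth_on (chart_image c) (\<Upsilon> c)) \<and>
     (\<forall>c\<in>A. \<forall>c'\<in>A. \<forall>x\<in>overlap c c'.
        \<Upsilon> c x = transpose (jacobian c c' x) *v \<Upsilon> c' (transition c c' x))"

text \<open>Covariant derivatives of weight \<open>w\<close> densities and weight \<open>w\<close> vector fields. In dimension
  \<open>n + 1 = CARD('m)\<close>, the components of a weight \<open>w\<close> density change by \<open>\<bar>det J\<bar> powr (w / (n + 2))\<close>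
  under a coordinate change with Jacobian \<open>J\<close>, whence the coefficient of the trace of \<open>G\<close>.\<close>

definition cov_density ::
  "real \<Rightarrow> 'm::finite local_connection \<Rightarrow> (real^'m \<Rightarrow> real) \<Rightarrow> real^'m \<Rightarrow> 'm \<Rightarrow> real" where
  "cov_density w G f x a =
     partial a f x + w / (real CARD('m) + 1) * (\<Sum>d\<in>UNIV. G x a d d) * f x"

definition cov_vector ::
  "real \<Rightarrow> 'm::finite local_connection \<Rightarrow> (real^'m \<Rightarrow> real^'m) \<Rightarrow> real^'m \<Rightarrow> 'm \<Rightarrow> 'm \<Rightarrow> real" where
  "cov_vector w G \<xi> x a b =
     partial a (\<lambda>y. \<xi> y $ b) x + (\<Sum>d\<in>UNIV. G x a d b * \<xi> x $ d)
     + w / (real CARD('m) + 1) * (\<Sum>d\<in>UNIV. G x a d d) * \<xi> x $ b"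

text \<open>\<open>projective_change A \<Upsilon> \<Gamma> \<Gamma>'\<close> is the relation \<open>\<Gamma>' = \<Gamma> + \<Upsilon>\<close>.\<close>

definition projective_change ::
  "('p, 'm::finite) chart set \<Rightarrow> ('p, 'm) covector_field \<Rightarrow> ('p, 'm) connection \<Rightarrow> ('p, 'm) connection \<Rightarrow> bool" where
  "projective_change A \<Upsilon> \<Gamma> \<Gamma>' \<longleftrightarrow> one_form A \<Upsilon> \<and>
     (\<forall>c\<in>A. \<forall>\<xi>. smooth_on (chart_image c) \<xi> \<longrightarrow> (\<forall>x\<in>chart_image c. \<forall>a b.
        cov_vector 0 (\<Gamma>' c) \<xi> x a b =
        cov_vector 0 (\<Gamma> c) \<xi> x a b + \<Upsilon> c x $ a * \<xi> x $ b
          + (\<Sum>d\<in>UNIV. \<Upsilon> c x $ d * \<xi> x $ d) * (if a = b then 1 else 0)))"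

definition projective_structure :: "('p, 'm::finite) chart set \<Rightarrow> ('p, 'm) connection set \<Rightarrow> bool" where
  "projective_structure A PS \<longleftrightarrow>
     (\<exists>\<Gamma>. affine_connection A \<Gamma> \<and> torsion_free A \<Gamma> \<and>
        PS = {\<Gamma>'. affine_connection A \<Gamma>' \<and> torsion_free A \<Gamma>' \<and> (\<exists>\<Upsilon>. projective_change A \<Upsilon> \<Gamma> \<Gamma>')})"

text \<open>\<open>curvature G x a b c d\<close> has lower indices \<open>a\<close>, \<open>b\<close>, \<open>d\<close> and upper index \<open>c\<close>; it represents the
  commutator of \<open>\<nabla>\<^sub>a\<close> and \<open>\<nabla>\<^sub>b\<close> on vector fields.\<close>

definition curvature :: "'m::finite local_connection \<Rightarrow> real^'m \<Rightarrow> 'm \<Rightarrow> 'm \<Rightarrow> 'm \<Rightarrow> 'm \<Rightarrow> real" where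
  "curvature G x a b c d =
     partial a (\<lambda>y. G y b d c) x - partial b (\<lambda>y. G y a d c) x
     + (\<Sum>e\<in>UNIV. G x a e c * G x b d e - G x b e c * G x a d e)"

definition ricci :: "'m::finite local_connection \<Rightarrow> real^'m \<Rightarrow> 'm \<Rightarrow> 'm \<Rightarrow> real" where
  "ricci G x a b = (\<Sum>d\<in>UNIV. curvature G x d a d b)"

text \<open>The Ricci tensor of a scale that is not special need not be symmetric. The projective Schouten
  tensor of a general scale in dimension \<open>n + 1\<close> is determined by
  \<open>R\<^sub>a\<^sub>b = (n + 1) P\<^sub>a\<^sub>b - P\<^sub>b\<^sub>a\<close>, that is
  \<open>P\<^sub>a\<^sub>b = ((n + 1) R\<^sub>a\<^sub>b + R\<^sub>b\<^sub>a) / (n (n + 2))\<close>; this is what makes the tractor connection below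
  independent of the scale.\<close>

definition schouten :: "'m::finite local_connection \<Rightarrow> real^'m \<Rightarrow> 'm \<Rightarrow> 'm \<Rightarrow> real" where
  "schouten G x a b =
     (real CARD('m) * ricci G x a b + ricci G x b a) / ((real CARD('m) - 1) * (real CARD('m) + 1))"

lemma schouten_symmetric_ricci:
  fixes G :: "'m::finite local_connection"
  assumes "ricci G x a b = ricci G x b a"
  shows "schouten G x a b = ricci G x a b / (real CARD('m) - 1)"
proof -
  have "schouten G x a b =
      (ricci G x a b * (real CARD('m) + 1)) / ((real CARD('m) - 1) * (real CARD('m) + 1))"
    unfolding schouten_def using assms by (simp add: algebra_simps)
  also have "\<dots> = ricci G x a b / (real CARD('m) - 1)"
    by (rule mult_divide_mult_cancel_right) (metis of_nat_1 of_nat_add of_nat_eq_0_iff add_is_0 one_neq_zero)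
  finally show ?thesis .
qed


section \<open>Tractors\<close>

text \<open>A scale (a connection in the projective class) and a chart trivialise the tractor bundle. In
  the index type \<open>'m option\<close>, \<open>Some a\<close> is the \<open>W\<^sub>a\<close>-slot and \<open>None\<close> is the \<open>X\<close>-slot. Tractor fields
  are families of components over all scales and charts, related by the transition matrices
  \<open>chart_change\<close> (for \<open>\<xi>\<close> and \<open>\<rho>\<close> of weight \<open>-1\<close>) and \<open>scale_change\<close> (\<open>\<rho>\<close> becomes \<open>\<rho> - \<Upsilon>\<^sub>a \<xi>\<^sup>a\<close>, as
  \<open>W\<^sub>a\<close> becomes \<open>W\<^sub>a + \<Upsilon>\<^sub>a X\<close>).\<close>

type_synonym ('p, 'm, 'v) tractor_components =
  "('p, 'm) connection \<Rightarrow> ('p, 'm) chart \<Rightarrow> real^'m \<Rightarrow> 'v"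
type_synonym ('p, 'm) tractor1 = "('p, 'm, real^('m option)) tractor_components"
type_synonym ('p, 'm) tractor2 = "('p, 'm, real^('m option)^('m option)) tractor_components"

definition chart_change ::
  "('p, 'm::finite) chart \<Rightarrow> ('p, 'm) chart \<Rightarrow> real^'m \<Rightarrow> real^('m option)^('m option)" where
  "chart_change c c' x = \<bar>det (jacobian c c' x)\<bar> powr (- 1 / (real CARD('m) + 1)) *\<^sub>R
     (\<chi> i j. case (i, j) of
        (Some a, Some b) \<Rightarrow> jacobian c c' x $ a $ b
      | (None, None) \<Rightarrow> 1
      | _ \<Rightarrow> 0)"

definition scale_change :: "real^'m::finite \<Rightarrow> real^('m option)^('m option)" where
  "scale_change u =
     (\<chi> i j. case (i, j) of
        (None, Some b) \<Rightarrow> - u $ b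
      | _ \<Rightarrow> if i = j then 1 else 0)"

definition tractor_field ::
  "('p, 'm::finite) chart set \<Rightarrow> ('p, 'm) connection set \<Rightarrow> ('p, 'm) tractor1 \<Rightarrow> bool" where
  "tractor_field A PS T \<longleftrightarrow>
     (\<forall>\<Gamma>\<in>PS. \<forall>c\<in>A. smooth_on (chart_image c) (T \<Gamma> c)) \<and>
     (\<forall>\<Gamma>\<in>PS. \<forall>c\<in>A. \<forall>c'\<in>A. \<forall>x\<in>overlap c c'.
        T \<Gamma> c' (transition c c' x) = chart_change c c' x *v T \<Gamma> c x) \<and>
     (\<forall>\<Gamma>\<in>PS. \<forall>\<Gamma>'\<in>PS. \<forall>\<Upsilon>. projective_change A \<Upsilon> \<Gamma> \<Gamma>' \<longrightarrow>
        (\<forall>c\<in>A. \<forall>x\<in>chart_image c. T \<Gamma>' c x = scale_change (\<Upsilon> c x) *v T \<Gamma> c x))"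

definition symmetric_tractor_field ::
  "('p, 'm::finite) chart set \<Rightarrow> ('p, 'm) connection set \<Rightarrow> ('p, 'm) tractor2 \<Rightarrow> bool" where
  "symmetric_tractor_field A PS H \<longleftrightarrow>
     (\<forall>\<Gamma>\<in>PS. \<forall>c\<in>A. smooth_on (chart_image c) (H \<Gamma> c)) \<and>
     (\<forall>\<Gamma>\<in>PS. \<forall>c\<in>A. \<forall>x\<in>chart_image c. transpose (H \<Gamma> c x) = H \<Gamma> c x) \<and>
     (\<forall>\<Gamma>\<in>PS. \<forall>c\<in>A. \<forall>c'\<in>A. \<forall>x\<in>overlap c c'.
        H \<Gamma> c' (transition c c' x) =
        chart_change c c' x ** H \<Gamma> c x ** transpose (chart_change c c' x)) \<and>
     (\<forall>\<Gamma>\<in>PS. \<forall>\<Gamma>'\<in>PS. \<forall>\<Upsilon>. projective_change A \<Upsilon> \<Gamma> \<Gamma>' \<longrightarrow>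
        (\<forall>c\<in>A. \<forall>x\<in>chart_image c.
           H \<Gamma>' c x = scale_change (\<Upsilon> c x) ** H \<Gamma> c x ** transpose (scale_change (\<Upsilon> c x))))"

definition tractor_deriv ::
  "'m::finite local_connection \<Rightarrow> (real^'m \<Rightarrow> real^('m option)) \<Rightarrow> real^'m \<Rightarrow> 'm \<Rightarrow> real^('m option)" where
  "tractor_deriv G T x c =
     (\<chi> i. case i of
        Some a \<Rightarrow> cov_vector (- 1) G (\<lambda>y. \<chi> b. T y $ Some b) x c a + (if c = a then T x $ None else 0)
      | None \<Rightarrow> cov_density (- 1) G (\<lambda>y. T y $ None) x c
                 - (\<Sum>a\<in>UNIV. schouten G x c a * T x $ Some a))"

text \<open>Connection matrix of the tractor connection, and the Leibniz extension to tractors with two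
  upper indices.\<close>

definition tractor_conn_matrix ::
  "'m::finite local_connection \<Rightarrow> real^'m \<Rightarrow> 'm \<Rightarrow> real^('m option)^('m option)" where
  "tractor_conn_matrix G x c = (\<chi> i j. tractor_deriv G (\<lambda>_. axis j 1) x c $ i)"

definition tractor2_deriv ::
  "'m::finite local_connection \<Rightarrow> (real^'m \<Rightarrow> real^('m option)^('m option)) \<Rightarrow> real^'m \<Rightarrow> 'm
     \<Rightarrow> real^('m option)^('m option)" where
  "tractor2_deriv G H x c =
     partial c H x + tractor_conn_matrix G x c ** H x + H x ** transpose (tractor_conn_matrix G x c)"

definition parallel_tractor ::
  "('p, 'm::finite) chart set \<Rightarrow> ('p, 'm) connection set \<Rightarrow> ('p, 'm) tractor1 \<Rightarrow> bool" where
  "parallel_tractor A PS T \<longleftrightarrow>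
     (\<forall>\<Gamma>\<in>PS. \<forall>c\<in>A. \<forall>x\<in>chart_image c. \<forall>a. tractor_deriv (\<Gamma> c) (T \<Gamma> c) x a = 0)"

definition parallel_tractor2 ::
  "('p, 'm::finite) chart set \<Rightarrow> ('p, 'm) connection set \<Rightarrow> ('p, 'm) tractor2 \<Rightarrow> bool" where
  "parallel_tractor2 A PS H \<longleftrightarrow>
     (\<forall>\<Gamma>\<in>PS. \<forall>c\<in>A. \<forall>x\<in>chart_image c. \<forall>a. tractor2_deriv (\<Gamma> c) (H \<Gamma> c) x a = 0)"

definition has_signature :: "real^'k^'k::finite \<Rightarrow> nat \<Rightarrow> nat \<Rightarrow> bool" where
  "has_signature B q p \<longleftrightarrow>
     (\<exists>(S :: real^'k^'k) (d :: 'k \<Rightarrow> real). invertible S \<and> transpose S ** B ** S = (\<chi> i j. if i = j then d i else 0) \<and>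
        (\<forall>i. d i = - 1 \<or> d i = 1) \<and> card {i. d i = - 1} = q \<and> card {i. d i = 1} = p)"

definition tractor2_signature ::
  "('p, 'm::finite) chart set \<Rightarrow> ('p, 'm) connection set \<Rightarrow> ('p, 'm) tractor2 \<Rightarrow> nat \<Rightarrow> nat \<Rightarrow> bool" where
  "tractor2_signature A PS H q p \<longleftrightarrow>
     (\<forall>\<Gamma>\<in>PS. \<forall>c\<in>A. \<forall>x\<in>chart_image c. has_signature (H \<Gamma> c x) q p)"

definition nondegenerate_tractor2 ::
  "('p, 'm::finite) chart set \<Rightarrow> ('p, 'm) connection set \<Rightarrow> ('p, 'm) tractor2 \<Rightarrow> bool" where
  "nondegenerate_tractor2 A PS H \<longleftrightarrow>
     (\<forall>\<Gamma>\<in>PS. \<forall>c\<in>A. \<forall>x\<in>chart_image c. invertible (H \<Gamma> c x))"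

definition tractor2_inverse :: "('p, 'm::finite) tractor2 \<Rightarrow> ('p, 'm) tractor2" where
  "tractor2_inverse H \<Gamma> c x = matrix_inv (H \<Gamma> c x)"

text \<open>The canonical tractor \<open>X\<close> has weight \<open>1\<close>; its components are the same in all charts and
  scales.\<close>

definition canonical_tractor :: "('p, 'm::finite) tractor1" where
  "canonical_tractor \<Gamma> c x = axis None 1"

definition tractor_pairing ::
  "('p, 'm::finite) tractor2 \<Rightarrow> ('p, 'm) tractor1 \<Rightarrow> ('p, 'm) tractor1 \<Rightarrow> ('p, 'm, real) tractor_components" where
  "tractor_pairing \<Phi> S T \<Gamma> c x = (\<Sum>i\<in>UNIV. \<Sum>j\<in>UNIV. \<Phi> \<Gamma> c x $ i $ j * S \<Gamma> c x $ i * T \<Gamma> c x $ j)"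

definition tractor_projection :: "('p, 'm::finite) tractor1 \<Rightarrow> ('p, 'm, real^'m) tractor_components" where
  "tractor_projection T \<Gamma> c x = (\<chi> a. T \<Gamma> c x $ Some a)"

definition nowhere_vanishing ::
  "('p, 'm::finite) chart set \<Rightarrow> ('p, 'm) connection set \<Rightarrow> ('p, 'm, 'v::zero) tractor_components \<Rightarrow> bool" where
  "nowhere_vanishing A PS s \<longleftrightarrow> (\<forall>\<Gamma>\<in>PS. \<forall>c\<in>A. \<forall>x\<in>chart_image c. s \<Gamma> c x \<noteq> 0)"

definition points_where ::
  "('p, 'm::finite) chart set \<Rightarrow> ('p, 'm) connection set \<Rightarrow> ('p, 'm, 'v) tractor_components \<Rightarrow> ('v \<Rightarrow> bool) \<Rightarrow> 'p set" where
  "points_where A PS s Q = {p. \<forall>\<Gamma>\<in>PS. \<forall>c\<in>A. p \<in> chart_dom c \<longrightarrow> Q (s \<Gamma> c (coord c p))}"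

definition zero_locus ::
  "('p, 'm::finite) chart set \<Rightarrow> ('p, 'm) connection set \<Rightarrow> ('p, 'm, 'v::zero) tractor_components \<Rightarrow> 'p set" where
  "zero_locus A PS s = points_where A PS s (\<lambda>v. v = 0)"

definition disjoint_decomposition :: "'p set \<Rightarrow> 'p set list \<Rightarrow> bool" where
  "disjoint_decomposition S Bs \<longleftrightarrow>
     S = \<Union> (set Bs) \<and> (\<forall>i < length Bs. \<forall>j < length Bs. i \<noteq> j \<longrightarrow> Bs ! i \<inter> Bs ! j = {})"

end

theory Submission
  imports Defs
begin

text \<open>
  In a chart and a scale the tractor connection is \<open>d + A\<close>, and \<open>A\<^sub>a X = W\<^sub>a\<close> modulo \<open>X\<close>. As \<open>I\<close> and
  \<open>H\<close> are parallel, \<open>\<nabla>\<^sub>a \<sigma>\<close> and \<open>\<nabla>\<^sub>a \<lambda>\<close> are \<open>\<Phi>(I, W\<^sub>a)\<close> and \<open>2 \<Phi>(X, W\<^sub>a)\<close>, whereas \<open>\<sigma>\<close> and \<open>\<lambda>\<close>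
  are the \<open>X\<close>-components of the same covectors. Since \<open>\<Phi>\<close> is non-degenerate and \<open>I\<close> does not
  vanish, \<open>d\<sigma> \<noteq> 0\<close> where \<open>\<sigma> = 0\<close>; where \<open>\<sigma> = \<lambda> = 0\<close>, \<open>d\<sigma>\<close> and \<open>d\<lambda>\<close> are independent unless
  \<open>I\<close> is a multiple of \<open>X\<close>, that is unless \<open>n = 0\<close>. At a zero of \<open>n\<close>, \<open>I = \<rho> X\<close> with \<open>\<rho> \<noteq> 0\<close>: then
  \<open>\<sigma> = \<lambda> = 0\<close> because \<open>I\<close> is null, and \<open>\<nabla>\<^sub>a n\<^sup>b = - \<rho> \<delta>\<^sub>a\<^sup>b\<close>, so the zero is isolated. The inverse
  function theorem, with smoothness of the inverse obtained from Cramer's rule, turns \<open>\<sigma>\<close> and \<open>\<lambda>\<close>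
  into coordinates.
\<close>

section \<open>Calculus of smooth maps\<close>

lemma ck_on_subset: "ck_on k S f \<Longrightarrow> T \<subseteq> S \<Longrightarrow> ck_on k T f"
  by (induction k arbitrary: f) (auto intro: continuous_on_subset)

lemma ck_on_Suc_imp: "ck_on (Suc k) S f \<Longrightarrow> ck_on k S f"
proof (induction k arbitrary: f)
  case 0
  then show ?case
    by (auto intro!: continuous_at_imp_continuous_on differentiable_imp_continuous_within)
next
  case (Suc k)
  then show ?case by (metis ck_on.simps(2))
qed

text \<open>Agreement on an open set is agreement near each of its points, so the derivatives agree
  on \<open>S\<close> as well and the induction passes to them.\<close>

lemma ck_on_cong:
  assumes "open S" "\<And>x. x \<in> S \<Longrightarrow> f x = g x" "ck_on k S f"
  shows "ck_on k S g"
  using assms(2,3)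
proof (induction k arbitrary: f g)
  case 0
  then show ?case by (auto cong: continuous_on_cong)
next
  case (Suc k)
  have diff: "f differentiable (at x)" if "x \<in> S" for x
    using Suc.prems that by auto
  have "frechet_derivative f (at x) = frechet_derivative g (at x)" if "x \<in> S" for x
    using frechet_derivative_transform_within_open[OF diff[OF that] assms(1) that Suc.prems(1)] .
  then have "ck_on k S (\<lambda>x. frechet_derivative g (at x) v)" for v
    using Suc.IH[of "\<lambda>x. frechet_derivative f (at x) v"] Suc.prems(2) by auto
  moreover have "g differentiable (at x)" if "x \<in> S" for x
    using diff[OF that] has_derivative_transform_within_open[OF _ assms(1) that, of f _ UNIV g] Suc.prems(1)
    unfolding differentiable_def by blast
  ultimately show ?case by simp
qed

text \<open>\<open>ck_on\<close> speaks of \<open>frechet_derivative\<close>, which is a choice;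
  uniqueness of the derivative lets an explicit formula stand in for it. The differentiation rules
  below enter through this lemma.\<close>

lemma ck_on_SucI:
  assumes "open S" "\<And>x. x \<in> S \<Longrightarrow> (f has_derivative f' x) (at x)" "\<And>v. ck_on k S (\<lambda>x. f' x v)"
  shows "ck_on (Suc k) S f"
proof -
  have "frechet_derivative f (at x) = f' x" if "x \<in> S" for x
    using frechet_derivative_at[OF assms(2)[OF that]] by simp
  then show ?thesis
    using assms by (auto simp: differentiable_def intro: ck_on_cong[OF assms(1) _ assms(3)])
qed

lemma ck_on_Suc_derivative:
  assumes "ck_on (Suc k) S f" "x \<in> S"
  shows "(f has_derivative frechet_derivative f (at x)) (at x)"
  using assms frechet_derivative_works by auto

lemma ck_on_const: "ck_on k S (\<lambda>x. c)"
  by (induction k arbitrary: c) auto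

lemma ck_on_bounded_linear:
  assumes "bounded_linear L" "open S" "ck_on k S f"
  shows "ck_on k S (\<lambda>x. L (f x))"
  using assms(3)
proof (induction k arbitrary: f)
  case 0
  then show ?case using bounded_linear.continuous_on[OF assms(1)] by auto
next
  case (Suc k)
  show ?case
    using Suc.prems
    by (intro ck_on_SucI[OF assms(2), where f' = "\<lambda>x v. L (frechet_derivative f (at x) v)"]
        bounded_linear.has_derivative[OF assms(1)] ck_on_Suc_derivative Suc.IH) auto
qed

lemma ck_on_id: "open S \<Longrightarrow> ck_on k S (\<lambda>x. x)"
proof (cases k)
  case (Suc l)
  then show "open S \<Longrightarrow> ck_on k S (\<lambda>x. x)"
    using ck_on_SucI[of S "\<lambda>x. x" "\<lambda>x v. v" l] ck_on_const by auto
qed auto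

lemma ck_on_add:
  assumes "open S" "ck_on k S f" "ck_on k S g"
  shows "ck_on k S (\<lambda>x. f x + g x)"
  using assms(2,3)
proof (induction k arbitrary: f g)
  case 0
  then show ?case by (auto intro: continuous_on_add)
next
  case (Suc k)
  show ?case
    using Suc.prems
    by (intro ck_on_SucI[OF assms(1),
          where f' = "\<lambda>x v. frechet_derivative f (at x) v + frechet_derivative g (at x) v"]
        has_derivative_add ck_on_Suc_derivative Suc.IH) auto
qed

lemma ck_on_bilinear:
  assumes "bounded_bilinear B" "open S" "ck_on k S f" "ck_on k S g"
  shows "ck_on k S (\<lambda>x. B (f x) (g x))"
  using assms(3,4)
proof (induction k arbitrary: f g)
  case 0
  then show ?case using bounded_bilinear.continuous_on[OF assms(1)] by auto
next
  case (Suc k)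
  show ?case
    using Suc.prems ck_on_Suc_imp[OF Suc.prems(1)] ck_on_Suc_imp[OF Suc.prems(2)]
    by (intro ck_on_SucI[OF assms(2), where f' = "\<lambda>x v. B (f x) (frechet_derivative g (at x) v) +
          B (frechet_derivative f (at x) v) (g x)"]
        bounded_bilinear.FDERIV[OF assms(1)] ck_on_Suc_derivative ck_on_add[OF assms(2)] Suc.IH) auto
qed

lemma ck_on_mult:
  fixes f g :: "_ \<Rightarrow> real"
  shows "open S \<Longrightarrow> ck_on k S f \<Longrightarrow> ck_on k S g \<Longrightarrow> ck_on k S (\<lambda>x. f x * g x)"
  by (rule ck_on_bilinear[OF bounded_bilinear_mult])

lemma ck_on_sum:
  assumes "open S" "\<And>i. i \<in> J \<Longrightarrow> ck_on k S (f i)"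
  shows "ck_on k S (\<lambda>x. \<Sum>i\<in>J. f i x)"
  using assms(2)
  by (induction J rule: infinite_finite_induct) (auto intro: ck_on_const ck_on_add[OF assms(1)])

lemma ck_on_prod:
  fixes f :: "_ \<Rightarrow> _ \<Rightarrow> real"
  assumes "open S" "\<And>i. i \<in> J \<Longrightarrow> ck_on k S (f i)"
  shows "ck_on k S (\<lambda>x. \<Prod>i\<in>J. f i x)"
  using assms(2)
  by (induction J rule: infinite_finite_induct) (auto intro: ck_on_const ck_on_mult[OF assms(1)])

lemma ck_on_inverse:
  fixes f :: "'a::real_normed_vector \<Rightarrow> real"
  assumes "open S" "\<And>x. x \<in> S \<Longrightarrow> f x \<noteq> 0" "ck_on k S f"
  shows "ck_on k S (\<lambda>x. inverse (f x))"
  using assms(3)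
proof (induction k)
  case 0
  then show ?case using assms(2) by (auto intro: continuous_on_inverse)
next
  case (Suc k)
  \<comment> \<open>The derivative of the reciprocal contains the reciprocal again, but only to
    order \<open>k\<close>, which the induction hypothesis supplies.\<close>
  have I: "ck_on k S (\<lambda>x. inverse (f x))"
    using Suc ck_on_Suc_imp by blast
  have "ck_on k S (\<lambda>x. - 1 * (inverse (f x) * frechet_derivative f (at x) v * inverse (f x)))" for v
    using Suc.prems by (intro ck_on_mult[OF assms(1)] ck_on_const I) auto
  then show ?case
    using Suc.prems assms(2)
    by (intro ck_on_SucI[OF assms(1), where
          f' = "\<lambda>x v. - (inverse (f x) * frechet_derivative f (at x) v * inverse (f x))"]
        Deriv.has_derivative_inverse ck_on_Suc_derivative) auto
qed

lemma ck_on_componentwise: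
  fixes f :: "'a::real_normed_vector \<Rightarrow> 'b::euclidean_space"
  assumes "open S"
  shows "ck_on k S f \<longleftrightarrow> (\<forall>b\<in>Basis. ck_on k S (\<lambda>x. f x \<bullet> b))"
proof
  assume "ck_on k S f"
  then show "\<forall>b\<in>Basis. ck_on k S (\<lambda>x. f x \<bullet> b)"
    using ck_on_bounded_linear[OF bounded_linear_inner_left assms] by blast
next
  assume *: "\<forall>b\<in>Basis. ck_on k S (\<lambda>x. f x \<bullet> b)"
  have "ck_on k S (\<lambda>x. (f x \<bullet> b) *\<^sub>R b)" if "b \<in> Basis" for b
    using ck_on_bounded_linear[OF bounded_linear_scaleR_left assms] * that by blast
  then have "ck_on k S (\<lambda>x. \<Sum>b\<in>Basis. (f x \<bullet> b) *\<^sub>R b)"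
    by (intro ck_on_sum[OF assms]) auto
  then show "ck_on k S f"
    by (simp add: euclidean_representation)
qed

lemma ck_on_vec_nth:
  fixes f :: "'a::real_normed_vector \<Rightarrow> 'b::real_normed_vector^'n"
  shows "open S \<Longrightarrow> ck_on k S f \<Longrightarrow> ck_on k S (\<lambda>x. f x $ i)"
  by (rule ck_on_bounded_linear[OF bounded_linear_vec_nth])

lemma ck_on_vec:
  fixes f :: "'a::real_normed_vector \<Rightarrow> real^'n"
  assumes "open S" "\<And>i. ck_on k S (\<lambda>x. f x $ i)"
  shows "ck_on k S f"
proof (rule ck_on_componentwise[OF assms(1), THEN iffD2], rule)
  fix b :: "real^'n"
  assume "b \<in> Basis"
  then obtain i where "b = axis i 1" by (auto simp: Basis_vec_def)
  then show "ck_on k S (\<lambda>x. f x \<bullet> b)"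
    using assms(2)[of i] by (simp add: inner_axis)
qed

text \<open>The chain rule evaluates the derivative of \<open>g\<close> in a direction that moves
  with \<open>x\<close>, while \<open>ck_on\<close> controls fixed directions only. Expanding the
  moving direction in the basis of the intermediate Euclidean space gives a finite sum of products
  to which the induction hypothesis applies.\<close>

lemma ck_on_compose:
  fixes f :: "'a::real_normed_vector \<Rightarrow> 'b::euclidean_space"
  assumes "open S" "open T" "f ` S \<subseteq> T" "ck_on k S f" "ck_on k T g"
  shows "ck_on k S (\<lambda>x. g (f x))"
  using assms(4,5)
proof (induction k arbitrary: g)
  case 0
  then show ?case using continuous_on_compose2 assms(3) by auto
next
  case (Suc k)
  let ?f' = "\<lambda>x. frechet_derivative f (at x)" and ?g' = "\<lambda>x. frechet_derivative g (at x)"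
  have f: "ck_on k S f" using Suc.prems ck_on_Suc_imp by blast
  have *: "?g' (f x) (?f' x v) = (\<Sum>b\<in>Basis. (?f' x v \<bullet> b) *\<^sub>R ?g' (f x) b)" if "x \<in> S" for x v
  proof -
    have "linear (?g' (f x))"
      using ck_on_Suc_derivative[OF Suc.prems(2)] assms(3) that
      by (meson has_derivative_linear image_subset_iff)
    then have "?g' (f x) (\<Sum>b\<in>Basis. (?f' x v \<bullet> b) *\<^sub>R b) = (\<Sum>b\<in>Basis. (?f' x v \<bullet> b) *\<^sub>R ?g' (f x) b)"
      by (simp add: linear_sum linear_cmul)
    then show ?thesis by (simp add: euclidean_representation)
  qed
  have 1: "ck_on k S (\<lambda>x. \<Sum>b\<in>Basis. (?f' x v \<bullet> b) *\<^sub>R ?g' (f x) b)" for v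
  proof (intro ck_on_sum[OF assms(1)] ck_on_bilinear[OF bounded_bilinear_scaleR assms(1)])
    show "ck_on k S (\<lambda>x. ?f' x v \<bullet> b)" for b
      using Suc.prems by (intro ck_on_bounded_linear[OF bounded_linear_inner_left assms(1)]) auto
    show "ck_on k S (\<lambda>x. ?g' (f x) b)" for b
      using Suc.IH[OF f, of "\<lambda>y. ?g' y b"] Suc.prems by auto
  qed
  show ?case
  proof (rule ck_on_SucI[OF assms(1)])
    show "((\<lambda>x. g (f x)) has_derivative (\<lambda>v. ?g' (f x) (?f' x v))) (at x)" if "x \<in> S" for x
      using diff_chain_at[OF ck_on_Suc_derivative[OF Suc.prems(1) that]
          ck_on_Suc_derivative[OF Suc.prems(2)]] assms(3) that by (auto simp: o_def)
    show "ck_on k S (\<lambda>x. ?g' (f x) (?f' x v))" for v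
      using ck_on_cong[OF assms(1) _ 1] * by simp
  qed
qed

lemma ck_on_det:
  fixes F :: "'a::real_normed_vector \<Rightarrow> real^'n^'n"
  assumes "open S" "\<And>i j. ck_on k S (\<lambda>x. F x $ i $ j)"
  shows "ck_on k S (\<lambda>x. det (F x))"
  unfolding det_def
  by (intro ck_on_sum ck_on_mult ck_on_prod ck_on_const assms)

text \<open>Cramer's rule writes each component of \<open>u\<close> as a quotient of determinants,
  so a mere pointwise solution inherits the regularity of the system. This serves both for the
  inverse function theorem and for inverting \<open>H\<close>.\<close>

lemma ck_on_linear_solution:
  fixes F :: "'a::real_normed_vector \<Rightarrow> real^'n^'n"
  assumes "open S" "\<And>i j. ck_on k S (\<lambda>x. F x $ i $ j)" "\<And>i. ck_on k S (\<lambda>x. b x $ i)"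
    and "\<And>x. x \<in> S \<Longrightarrow> det (F x) \<noteq> 0" "\<And>x. x \<in> S \<Longrightarrow> F x *v u x = b x"
  shows "ck_on k S u"
proof (rule ck_on_vec[OF assms(1)])
  fix l
  let ?D = "\<lambda>x. det (\<chi> i j. if j = l then b x $ i else F x $ i $ j) * inverse (det (F x))"
  have entry: "ck_on k S (\<lambda>x. (\<chi> i j. if j = l then b x $ i else F x $ i $ j) $ i $ j)" for i j
    using assms(2,3) by (cases "j = l") auto
  have D: "ck_on k S ?D"
    by (intro ck_on_mult[OF assms(1)] ck_on_det[OF assms(1)] entry ck_on_inverse[OF assms(1)] assms)
  have "u x $ l = ?D x" if "x \<in> S" for x
    using cramer[OF assms(4)[OF that], of "u x" "b x"] assms(5)[OF that]
    by (simp add: divide_inverse)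
  then show "ck_on k S (\<lambda>x. u x $ l)"
    using ck_on_cong[OF assms(1) _ D] by simp
qed

section \<open>Smooth maps and the inverse function theorem\<close>

lemma smooth_on_cong:
  "open S \<Longrightarrow> (\<And>x. x \<in> S \<Longrightarrow> f x = g x) \<Longrightarrow> smooth_on S f \<Longrightarrow> smooth_on S g"
  unfolding smooth_on_def using ck_on_cong by blast

lemma smooth_on_subset: "smooth_on S f \<Longrightarrow> T \<subseteq> S \<Longrightarrow> smooth_on T f"
  unfolding smooth_on_def using ck_on_subset by blast

lemma smooth_on_compose:
  fixes f :: "'a::real_normed_vector \<Rightarrow> 'b::euclidean_space"
  shows "open S \<Longrightarrow> open T \<Longrightarrow> f ` S \<subseteq> T \<Longrightarrow> smooth_on S f \<Longrightarrow> smooth_on T g \<Longrightarrow> smooth_on S (\<lambda>x. g (f x))"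
  unfolding smooth_on_def using ck_on_compose by blast

lemma smooth_on_has_derivative:
  "smooth_on S f \<Longrightarrow> x \<in> S \<Longrightarrow> (f has_derivative frechet_derivative f (at x)) (at x)"
  unfolding smooth_on_def using ck_on_Suc_derivative by blast

lemma smooth_on_continuous: "smooth_on S f \<Longrightarrow> continuous_on S f"
  unfolding smooth_on_def using ck_on.simps(1) by blast

text \<open>The inverse function theorem provides a differentiable local inverse \<open>g\<close>,
  whose smoothness is bootstrapped: \<open>g' y v\<close> solves the linear system with right-hand
  side \<open>v\<close> and the derivative of \<open>f\<close> at \<open>g y\<close> as matrix. If
  \<open>g\<close> is of class C^k, so is this matrix, hence so is the solution, and
  \<open>g\<close> is of class C^(k+1).\<close>

lemma smooth_inverse_function:
  fixes f :: "real^'n \<Rightarrow> real^'n"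
  assumes "open U" "smooth_on U f" "x0 \<in> U"
    and inj: "\<And>v. frechet_derivative f (at x0) v = 0 \<Longrightarrow> v = 0"
  obtains U' V g where "open U'" "U' \<subseteq> U" "x0 \<in> U'" "open V" "homeomorphism U' V f g" "smooth_on V g"
proof -
  let ?D = "\<lambda>x. frechet_derivative f (at x)"
  define f' where "f' x = Blinfun (?D x)" for x
  have der: "(f has_derivative ?D x) (at x)" if "x \<in> U" for x
    using smooth_on_has_derivative[OF assms(2) that] .
  then have f': "blinfun_apply (f' x) = ?D x" if "x \<in> U" for x
    unfolding f'_def using bounded_linear_Blinfun_apply has_derivative_bounded_linear that by blast
  have ckD: "ck_on k U (\<lambda>x. ?D x v)" for k v
    using assms(2) unfolding smooth_on_def by (metis ck_on.simps(2))
  have "continuous_on U (\<lambda>x. f' x v)" for v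
    using ckD[of 0 v] f' by (auto cong: continuous_on_cong)
  \<comment> \<open>In finite dimension, continuity in each fixed direction gives continuity in the
    operator norm.\<close>
  then have contf: "continuous_on U f'"
    by (intro continuous_on_blinfun_componentwise) auto
  have lin0: "linear (?D x0)"
    using der[OF assms(3)] has_derivative_linear by blast
  then have "inj (?D x0)"
    using inj by (simp add: linear_injective_0)
  then obtain h where h: "linear h" "h \<circ> ?D x0 = id"
    using linear_injective_left_inverse[OF lin0] by blast
  \<comment> \<open>Injectivity at \<open>x0\<close> enters the inverse function theorem as a left
    inverse of the derivative.\<close>
  have "Blinfun h o\<^sub>L f' x0 = id_blinfun"
  proof (rule blinfun_eqI)
    fix v
    have "bounded_linear h"
      using h(1) linear_conv_bounded_linear by blast
    then show "blinfun_apply (Blinfun h o\<^sub>L f' x0) v = blinfun_apply id_blinfun v"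
      using fun_cong[OF h(2), of v] by (simp add: f'[OF assms(3)] bounded_linear_Blinfun_apply)
  qed
  then obtain U' V g g' where *: "open U'" "U' \<subseteq> U" "x0 \<in> U'" "open V" "f x0 \<in> V" "homeomorphism U' V f g"
    and g: "\<And>y. y \<in> V \<Longrightarrow> (g has_derivative (g' y)) (at y)"
    and g': "\<And>y. y \<in> V \<Longrightarrow> g' y = inv (blinfun_apply (f'(g y)))"
    and bij: "\<And>y. y \<in> V \<Longrightarrow> bij (blinfun_apply (f'(g y)))"
    using inverse_function_theorem[OF assms(1) _ contf assms(3)] der f' by metis
  have gU: "g y \<in> U" if "y \<in> V" for y
    using *(2,6) that unfolding homeomorphism_def by blast
  have gcont: "continuous_on V g"
    using *(6) unfolding homeomorphism_def by blast
  have lin: "linear (?D (g y))" if "y \<in> V" for y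
    using der[OF gU[OF that]] has_derivative_linear by blast
  have mat: "matrix (?D (g y)) *v g' y v = v" if "y \<in> V" for y v
  proof -
    have "?D (g y) (g' y v) = v"
      using bij[OF that] by (simp add: g'[OF that] f'[OF gU[OF that]] bij_is_surj surj_f_inv_f)
    then show ?thesis
      using matrix_vector_mul(2)[OF lin[OF that]] by metis
  qed
  have det: "det (matrix (?D (g y))) \<noteq> 0" if "y \<in> V" for y
  proof -
    have "bij (?D (g y))" using bij[OF that] f'[OF gU[OF that]] by simp
    then show ?thesis
      using invertible_eq_bij[of "matrix (?D (g y))"] lin[OF that]
      by (simp add: invertible_det_nz matrix_vector_mul(2)[symmetric])
  qed
  have "ck_on k V g" for k
  proof (induction k)
    case 0
    then show ?case using gcont by simp
  next
    case (Suc k)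
    have "ck_on k V (\<lambda>y. ?D (g y) (axis j 1))" for j
      using ck_on_compose[OF *(4) assms(1) _ Suc ckD] gU by blast
    then have "ck_on k V (\<lambda>y. matrix (?D (g y)) $ i $ j)" for i j
      unfolding matrix_def using ck_on_vec_nth[OF *(4), of k "\<lambda>y. ?D (g y) (axis j 1)"] by simp
    then have "ck_on k V (\<lambda>y. g' y v)" for v
      using ck_on_linear_solution[OF *(4), of k "\<lambda>y. matrix (?D (g y))" "\<lambda>_. v"] mat det
      by (simp add: ck_on_const)
    then show ?case
      using ck_on_SucI[OF *(4) g] by blast
  qed
  then show ?thesis
    using that * unfolding smooth_on_def by blast
qed

section \<open>Charts\<close>

text \<open>\<open>is_chart\<close> only asserts that some continuous inverse exists. It must agree
  on the image with the chosen \<open>inv_into\<close> that occurs in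
  \<open>transition\<close>.\<close>

lemma chart_homeomorphism:
  assumes "is_chart c"
  shows "homeomorphism (chart_dom c) (chart_image c) (coord c) (inv_into (chart_dom c) (coord c))"
proof -
  obtain g where g: "homeomorphism (chart_dom c) (chart_image c) (coord c) g"
    using assms unfolding is_chart_def by blast
  have "inj_on (coord c) (chart_dom c)"
    using g unfolding homeomorphism_def inj_on_def by metis
  then have "g y = inv_into (chart_dom c) (coord c) y" if "y \<in> chart_image c" for y
    using g that unfolding homeomorphism_def by (metis f_inv_into_f inv_into_f_f inv_into_into image_eqI)
  then show ?thesis
    using homeomorphism_cong[OF g refl refl] by (metis (no_types, lifting))
qed

lemma chart_inj: "is_chart c \<Longrightarrow> inj_on (coord c) (chart_dom c)"
  using chart_homeomorphism[of c] unfolding homeomorphism_def by (metis inj_on_inverseI)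

lemma transition_coord: "is_chart c \<Longrightarrow> p \<in> chart_dom c \<Longrightarrow> transition c c' (coord c p) = coord c' p"
  unfolding transition_def by (simp add: chart_inj)

lemma open_coord_image:
  assumes "is_chart c" "open W"
  shows "open (coord c ` (chart_dom c \<inter> W))"
proof -
  have "openin (top_of_set (chart_dom c)) (chart_dom c \<inter> W)"
    using assms(2) by auto
  then have "openin (top_of_set (chart_image c)) (coord c ` (chart_dom c \<inter> W))"
    using homeomorphism_imp_open_map[OF chart_homeomorphism[OF assms(1)]] by blast
  then show ?thesis
    using assms(1) unfolding is_chart_def by (meson openin_open_trans)
qed

lemma open_overlap: "is_chart c \<Longrightarrow> is_chart c' \<Longrightarrow> open (overlap c c')"
  unfolding overlap_def by (rule open_coord_image) (auto simp: is_chart_def)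

lemma open_coord_preimage:
  assumes "is_chart c" "open U"
  shows "open (chart_dom c \<inter> coord c -` U)"
  using assms chart_homeomorphism[OF assms(1)] unfolding is_chart_def homeomorphism_def
  by (auto intro: continuous_open_preimage)

text \<open>The two transition maps compose to the identity on the open overlap; the chain rule
  turns this into the matrix identity.\<close>

lemma jacobian_inverse:
  fixes c c' :: "('p::topological_space, 'm::finite) chart"
  assumes "is_chart c" "is_chart c'" "compatible c c'" "x \<in> overlap c c'"
  shows "jacobian c' c (transition c c' x) ** jacobian c c' x = mat 1"
proof -
  let ?t = "transition c c'" and ?t' = "transition c' c"
  obtain p where p: "p \<in> chart_dom c" "p \<in> chart_dom c'" "x = coord c p"
    using assms(4) unfolding overlap_def by auto
  have y: "?t x = coord c' p"
    using p transition_coord[OF assms(1)] by simp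
  then have yin: "?t x \<in> overlap c' c"
    using p unfolding overlap_def by auto
  have d: "(?t has_derivative frechet_derivative ?t (at x)) (at x)"
    using assms(3,4) smooth_on_has_derivative unfolding compatible_def by blast
  have d': "(?t' has_derivative frechet_derivative ?t' (at (?t x))) (at (?t x))"
    using assms(3) yin smooth_on_has_derivative unfolding compatible_def by blast
  have comp: "(?t' \<circ> ?t has_derivative frechet_derivative ?t' (at (?t x)) \<circ> frechet_derivative ?t (at x)) (at x)"
    using diff_chain_at[OF d d'] .
  have "(?t' \<circ> ?t) z = z" if "z \<in> overlap c c'" for z
    using that assms(1,2) unfolding overlap_def by (auto simp: transition_coord)
  then have "((\<lambda>z. z) has_derivative frechet_derivative ?t' (at (?t x)) \<circ> frechet_derivative ?t (at x)) (at x)"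
    by (rule has_derivative_transform_within_open[OF comp open_overlap[OF assms(1,2)] assms(4)])
  then have "frechet_derivative ?t' (at (?t x)) \<circ> frechet_derivative ?t (at x) = (\<lambda>v. v)"
    using has_derivative_ident has_derivative_unique by blast
  moreover have "linear (frechet_derivative ?t (at x))" "linear (frechet_derivative ?t' (at (?t x)))"
    using d d' has_derivative_linear by auto
  ultimately show ?thesis
    unfolding jacobian_def using matrix_compose matrix_id_mat_1 by (metis (no_types, lifting) eq_id_iff)
qed

lemma det_jacobian_nonzero:
  fixes c c' :: "('p::topological_space, 'm::finite) chart"
  assumes "is_chart c" "is_chart c'" "compatible c c'" "x \<in> overlap c c'"
  shows "det (jacobian c c' x) \<noteq> 0"
  using jacobian_inverse[OF assms] invertible_det_nz invertible_left_inverse by blast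

section \<open>Adapted charts for level sets\<close>

text \<open>The transition from \<open>d\<close> to a chart \<open>c'\<close> is
  \<open>transition c c'\<close> after \<open>g\<close>, and the one back is \<open>F\<close> after
  \<open>transition c' c\<close>; smoothness of \<open>g\<close> and of \<open>F\<close> is what
  makes both smooth.\<close>

lemma reparametrised_chart:
  fixes A :: "('p::topological_space, 'm::finite) chart set"
  assumes A: "smooth_atlas A" "c \<in> A" and U: "open U" "U \<subseteq> chart_image c" and V: "open V"
    and hom: "homeomorphism U V F g" and F: "smooth_on U F" and g: "smooth_on V g"
  defines "d \<equiv> (chart_dom c \<inter> coord c -` U, F \<circ> coord c)"
  shows "d \<in> maximal_atlas A" "chart_image d = V"
proof -
  have c: "is_chart c" using A unfolding smooth_atlas_def by blast
  have img: "coord c ` (chart_dom c \<inter> coord c -` U) = U"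
    using U(2) unfolding chart_image_def by auto
  have FU: "F ` U = V" using hom unfolding homeomorphism_def by blast
  have gF: "g (F x) = x" if "x \<in> U" for x
    using hom that unfolding homeomorphism_def by blast
  show imd: "chart_image d = V"
    unfolding chart_image_def d_def fst_conv snd_conv image_comp[symmetric] img FU ..
  have h1: "homeomorphism (chart_dom c \<inter> coord c -` U) U (coord c) (inv_into (chart_dom c) (coord c))"
    using homeomorphism_of_subsets[OF chart_homeomorphism[OF c] _ _ img] U(2) by blast
  have d: "is_chart d"
    unfolding is_chart_def imd
    using V open_coord_preimage[OF c U(1)] homeomorphism_compose[OF h1 hom]
    by (auto simp: d_def)
  have "compatible d c'" if "c' \<in> A" for c'
  proof -
    have c': "is_chart c'" and comp: "compatible c c'"
      using A that unfolding smooth_atlas_def by auto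
    have s: "smooth_on (overlap d c') (\<lambda>y. transition c c' (g y))"
    proof (rule smooth_on_compose[where f = g and g = "transition c c'" and T = "overlap c c'"])
      show "g ` overlap d c' \<subseteq> overlap c c'"
        unfolding overlap_def d_def using gF by auto
      show "smooth_on (overlap d c') g"
        by (rule smooth_on_subset[OF g]) (auto simp: overlap_def chart_image_def imd[symmetric])
      show "smooth_on (overlap c c') (transition c c')"
        using comp unfolding compatible_def by blast
    qed (use open_overlap[OF d c'] open_overlap[OF c c'] in auto)
    have "transition c c' (g y) = transition d c' y" if "y \<in> overlap d c'" for y
    proof -
      obtain p where p: "p \<in> chart_dom d" "y = coord d p"
        using \<open>y \<in> overlap d c'\<close> unfolding overlap_def by auto
      then have "g y = coord c p" "p \<in> chart_dom c"
        using gF unfolding d_def by auto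
      then show ?thesis
        using p transition_coord[OF c] transition_coord[OF d] by metis
    qed
    then have 1: "smooth_on (overlap d c') (transition d c')"
      using smooth_on_cong[OF open_overlap[OF d c'] _ s] by simp
    have tr: "transition c' c x \<in> U \<and> F (transition c' c x) = transition c' d x"
      if "x \<in> overlap c' d" for x
    proof -
      obtain p where "p \<in> chart_dom d" "p \<in> chart_dom c'" "x = coord c' p"
        using \<open>x \<in> overlap c' d\<close> unfolding overlap_def by auto
      then show ?thesis
        using transition_coord[OF c'] unfolding d_def by auto
    qed
    have sub: "overlap c' d \<subseteq> overlap c' c"
      unfolding overlap_def d_def by auto
    have "smooth_on (overlap c' d) (\<lambda>x. F (transition c' c x))"
    proof (rule smooth_on_compose[OF open_overlap[OF c' d] U(1) _ _ F, where f = "transition c' c"])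
      show "transition c' c ` overlap c' d \<subseteq> U" using tr by auto
      show "smooth_on (overlap c' d) (transition c' c)"
        by (rule smooth_on_subset[OF _ sub]) (use comp in \<open>simp add: compatible_def\<close>)
    qed
    then have "smooth_on (overlap c' d) (transition c' d)"
      by (rule smooth_on_cong[OF open_overlap[OF c' d], rotated]) (use tr in blast)
    with 1 show ?thesis unfolding compatible_def by blast
  qed
  with d show "d \<in> maximal_atlas A"
    unfolding maximal_atlas_def by blast
qed

text \<open>The new coordinates are the functions \<open>f i\<close> for \<open>i \<in> J\<close> and the old coordinates otherwise.\<close>

lemma level_set_chart:
  fixes A :: "('p::topological_space, 'm::finite) chart set"
    and f :: "'m \<Rightarrow> real^'m \<Rightarrow> real"
  assumes A: "smooth_atlas A" "c \<in> A" and p: "p \<in> chart_dom c" "coord c p \<in> U"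
    and U: "open U" "U \<subseteq> chart_image c"
    and f: "\<And>i. i \<in> J \<Longrightarrow> smooth_on U (f i)"
    and inj: "\<And>v. (\<And>i. i \<notin> J \<Longrightarrow> v $ i = 0) \<Longrightarrow>
        (\<And>i. i \<in> J \<Longrightarrow> frechet_derivative (f i) (at (coord c p)) v = 0) \<Longrightarrow> v = 0"
    and S: "\<And>q. q \<in> chart_dom c \<Longrightarrow> coord c q \<in> U \<Longrightarrow> q \<in> S \<longleftrightarrow> (\<forall>i\<in>J. f i (coord c q) = 0)"
  shows "\<exists>d\<in>maximal_atlas A. \<exists>K. p \<in> chart_dom d \<and> card K = CARD('m) - card J \<and>
    coord d ` (chart_dom d \<inter> S) = chart_image d \<inter> {x. \<forall>i. i \<notin> K \<longrightarrow> x $ i = 0}"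
proof -
  define F where "F x = (\<chi> i. if i \<in> J then f i x else x $ i)" for x
  have "ck_on k U (\<lambda>x. F x $ i)" for k i
  proof (cases "i \<in> J")
    case True
    then show ?thesis using f unfolding F_def smooth_on_def by simp
  next
    case False
    then show ?thesis using ck_on_vec_nth[OF U(1) ck_on_id[OF U(1)]] unfolding F_def by simp
  qed
  then have F: "smooth_on U F"
    unfolding smooth_on_def using ck_on_vec[OF U(1)] by blast
  let ?x = "coord c p"
  have DF: "((\<lambda>x. F x $ i) has_derivative (\<lambda>v. frechet_derivative F (at ?x) v $ i)) (at ?x)" for i
    using bounded_linear.has_derivative[OF bounded_linear_vec_nth smooth_on_has_derivative[OF F p(2)]] .
  \<comment> \<open>A kernel vector of the derivative of \<open>F\<close> has zero components off
    \<open>J\<close> and is killed by the derivative of every \<open>f i\<close> with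
    \<open>i\<close> in \<open>J\<close>, so \<open>inj\<close> applies.\<close>
  have "v = 0" if v: "frechet_derivative F (at ?x) v = 0" for v
  proof (rule inj)
    show "v $ i = 0" if "i \<notin> J" for i
    proof -
      have "((\<lambda>x. x $ i) has_derivative (\<lambda>v. v $ i)) (at ?x)"
        using bounded_linear.has_derivative[OF bounded_linear_vec_nth has_derivative_ident] .
      then have "(\<lambda>v. frechet_derivative F (at ?x) v $ i) = (\<lambda>v. v $ i)"
        using has_derivative_unique[OF _ DF[of i]] that by (simp add: F_def)
      then show ?thesis
        using v by (metis zero_index)
    qed
    show "frechet_derivative (f i) (at ?x) v = 0" if "i \<in> J" for i
    proof -
      have "frechet_derivative (f i) (at ?x) = (\<lambda>v. frechet_derivative F (at ?x) v $ i)"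
        using has_derivative_unique[OF smooth_on_has_derivative[OF f[OF that] p(2)]] DF[of i] that
        by (simp add: F_def)
      then show ?thesis using v by simp
    qed
  qed
  then obtain U' V g where U': "open U'" "U' \<subseteq> U" "?x \<in> U'" and V: "open V"
    and hom: "homeomorphism U' V F g" and g: "smooth_on V g"
    using smooth_inverse_function[OF U(1) F p(2)] by blast
  let ?d = "(chart_dom c \<inter> coord c -` U', F \<circ> coord c)"
  have d: "?d \<in> maximal_atlas A" and im: "chart_image ?d = V"
    using reparametrised_chart[OF A U'(1) _ V hom smooth_on_subset[OF F U'(2)] g] U' U by auto
  \<comment> \<open>The functions \<open>f i\<close> have become the coordinates with index in
    \<open>J\<close>, so the free coordinates are those in \<open>- J\<close>.\<close>
  have "coord ?d ` (chart_dom ?d \<inter> S) = coord ?d ` chart_dom ?d \<inter> {x. \<forall>i. i \<notin> - J \<longrightarrow> x $ i = 0}"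
    using S U'(2) by (auto simp: F_def)
  then have "coord ?d ` (chart_dom ?d \<inter> S) = chart_image ?d \<inter> {x. \<forall>i. i \<notin> - J \<longrightarrow> x $ i = 0}"
    unfolding chart_image_def .
  moreover have "card (- J) = CARD('m) - card J"
    by (simp add: Compl_eq_Diff_UNIV card_Diff_subset)
  ultimately show ?thesis
    using d p(1) U'(3) by (intro bexI[OF _ d] exI[of _ "- J"]) auto
qed

text \<open>The function \<open>f\<close> replaces the coordinate \<open>j\<close>. A vector with
  all other components zero is a multiple of the axis \<open>j\<close>, on which the derivative of
  \<open>f\<close> is injective.\<close>

lemma hypersurface_chart:
  fixes A :: "('p::topological_space, 'm::finite) chart set"
    and f :: "real^'m \<Rightarrow> real"
  assumes A: "smooth_atlas A" "c \<in> A" and p: "p \<in> chart_dom c" "coord c p \<in> U"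
    and U: "open U" "U \<subseteq> chart_image c"
    and f: "smooth_on U f" and df: "partial j f (coord c p) \<noteq> 0"
    and S: "\<And>q. q \<in> chart_dom c \<Longrightarrow> coord c q \<in> U \<Longrightarrow> q \<in> S \<longleftrightarrow> f (coord c q) = 0"
  shows "\<exists>d\<in>maximal_atlas A. \<exists>K. p \<in> chart_dom d \<and> card K = CARD('m) - 1 \<and>
    coord d ` (chart_dom d \<inter> S) = chart_image d \<inter> {x. \<forall>i. i \<notin> K \<longrightarrow> x $ i = 0}"
proof -
  have lin: "linear (frechet_derivative f (at (coord c p)))"
    using smooth_on_has_derivative[OF f p(2)] has_derivative_linear by blast
  have "v = 0" if v: "\<And>i. i \<notin> {j} \<Longrightarrow> v $ i = 0" "frechet_derivative f (at (coord c p)) v = 0" for v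
  proof -
    have "v = (v $ j) *\<^sub>R axis j 1"
      using v(1) by (auto simp: vec_eq_iff axis_def)
    then have "v $ j * partial j f (coord c p) = 0"
      using v(2) linear_cmul[OF lin] unfolding partial_def by (metis real_scaleR_def)
    then show ?thesis
      using df v(1) by (auto simp: vec_eq_iff) (metis)
  qed
  then show ?thesis
    using level_set_chart[OF A p U, of "{j}" "\<lambda>_. f" S] f S by auto
qed

text \<open>The functions \<open>f\<close> and \<open>h\<close> replace the coordinates
  \<open>i\<close> and \<open>j\<close>. A vector in the plane of these two axes that both
  derivatives kill solves a two by two system whose determinant is the non-zero minor; the minor
  also forces \<open>i\<close> and \<open>j\<close> to be distinct.\<close>

lemma codimension_two_chart:
  fixes A :: "('p::topological_space, 'm::finite) chart set"
    and f h :: "real^'m \<Rightarrow> real"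
  assumes A: "smooth_atlas A" "c \<in> A" and p: "p \<in> chart_dom c" "coord c p \<in> U"
    and U: "open U" "U \<subseteq> chart_image c"
    and f: "smooth_on U f" and h: "smooth_on U h"
    and minor: "partial i f (coord c p) * partial j h (coord c p) \<noteq> partial j f (coord c p) * partial i h (coord c p)"
    and S: "\<And>q. q \<in> chart_dom c \<Longrightarrow> coord c q \<in> U \<Longrightarrow> q \<in> S \<longleftrightarrow> f (coord c q) = 0 \<and> h (coord c q) = 0"
  shows "\<exists>d\<in>maximal_atlas A. \<exists>K. p \<in> chart_dom d \<and> card K = CARD('m) - 2 \<and>
    coord d ` (chart_dom d \<inter> S) = chart_image d \<inter> {x. \<forall>i. i \<notin> K \<longrightarrow> x $ i = 0}"
proof -
  have ij: "i \<noteq> j" using minor by auto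
  let ?x = "coord c p"
  have D: "frechet_derivative u (at ?x) v = v $ i * partial i u ?x + v $ j * partial j u ?x"
    if u: "smooth_on U u" and v: "\<And>k. k \<notin> {i, j} \<Longrightarrow> v $ k = 0" for u :: "real^'m \<Rightarrow> real" and v
  proof -
    have lin: "linear (frechet_derivative u (at ?x))"
      using smooth_on_has_derivative[OF u p(2)] has_derivative_linear by blast
    have "v = (v $ i) *\<^sub>R axis i 1 + (v $ j) *\<^sub>R axis j 1"
      using v ij by (auto simp: vec_eq_iff axis_def)
    then show ?thesis
      unfolding partial_def using linear_cmul[OF lin] linear_add[OF lin] by (metis real_scaleR_def)
  qed
  have inj: "v = 0" if v: "\<And>k. k \<notin> {i, j} \<Longrightarrow> v $ k = 0" "frechet_derivative f (at ?x) v = 0"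
    "frechet_derivative h (at ?x) v = 0" for v
  proof -
    let ?m = "partial i f ?x * partial j h ?x - partial j f ?x * partial i h ?x"
    have e: "v $ i * partial i f ?x + v $ j * partial j f ?x = 0"
      "v $ i * partial i h ?x + v $ j * partial j h ?x = 0"
      using D[OF f v(1)] D[OF h v(1)] v(2,3) by auto
    have "v $ i * ?m = 0" "v $ j * ?m = 0"
      using e by algebra+
    then show ?thesis
      using minor v(1) by (auto simp: vec_eq_iff) (metis)
  qed
  have "\<exists>d\<in>maximal_atlas A. \<exists>K. p \<in> chart_dom d \<and> card K = CARD('m) - card {i, j} \<and>
    coord d ` (chart_dom d \<inter> S) = chart_image d \<inter> {x. \<forall>i. i \<notin> K \<longrightarrow> x $ i = 0}"
  proof (rule level_set_chart[OF A p U, where f = "\<lambda>k. if k = i then f else h"])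
    fix v :: "real^'m"
    assume "\<And>k. k \<notin> {i, j} \<Longrightarrow> v $ k = 0"
      and "\<And>k. k \<in> {i, j} \<Longrightarrow> frechet_derivative (if k = i then f else h) (at ?x) v = 0"
    from this(1) this(2)[of i] this(2)[of j] show "v = 0"
      using inj ij by simp
  qed (use f h S ij in auto)
  then show ?thesis using ij by (simp add: numeral_2_eq_2)
qed

section \<open>Linear algebra\<close>

lemma sum_UNIV_option: "(\<Sum>i\<in>(UNIV :: 'm::finite option set). f i) = f None + (\<Sum>a\<in>UNIV. f (Some a))"
  unfolding UNIV_option_conv by (subst sum.insert) (auto simp: sum.reindex o_def)

lemma matrix_inv_cancel:
  fixes B :: "real^'n^'n"
  assumes "invertible B"
  shows "B *v (matrix_inv B *v v) = v" "matrix_inv B *v (B *v v) = v"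
proof -
  have "\<exists>B'. B ** B' = mat 1 \<and> B' ** B = mat 1"
    using assms unfolding invertible_def by blast
  then have "B ** matrix_inv B = mat 1 \<and> matrix_inv B ** B = mat 1"
    unfolding matrix_inv_def by (rule someI_ex)
  then show "B *v (matrix_inv B *v v) = v" "matrix_inv B *v (B *v v) = v"
    by (simp_all add: matrix_vector_mul_assoc)
qed

lemma inner_vector_matrix: "u \<bullet> (w v* B) = (B *v u) \<bullet> w" for B :: "real^'n^'m"
  by (metis dot_lmul_matrix inner_commute)

lemma inner_matrix_inv_symmetric:
  fixes B :: "real^'n^'n"
  assumes "invertible B" "transpose B = B"
  shows "u \<bullet> (matrix_inv B *v w) = (matrix_inv B *v u) \<bullet> w"
proof -
  have "u \<bullet> (matrix_inv B *v w) = (B *v (matrix_inv B *v u)) \<bullet> (matrix_inv B *v w)"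
    by (simp add: matrix_inv_cancel[OF assms(1)])
  also have "\<dots> = (matrix_inv B *v u) \<bullet> (B *v (matrix_inv B *v w))"
    by (metis assms(2) dot_lmul_matrix transpose_matrix_vector)
  finally show ?thesis by (simp add: matrix_inv_cancel[OF assms(1)])
qed

text \<open>Meant for transition matrices \<open>S\<close> of tractors, which have the canonical
  tractor \<open>X\<close> as an eigenvector. Cancelling the injective \<open>S\<close> in
  \<open>B' *v (matrix_inv B' *v X) = X\<close> shows that the transposed \<open>S\<close> carries
  the new covector to the old one divided by \<open>k\<close>.\<close>

lemma inverse_pairing_transform:
  fixes B B' S :: "real^'n^'n"
  assumes B: "invertible B" and B': "invertible B'" and BS: "B' = S ** B ** transpose S"
    and S: "\<And>v. S *v v = 0 \<Longrightarrow> v = 0" and X: "S *v X = k *\<^sub>R X" and k: "k \<noteq> 0"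
  shows "(S *v t) \<bullet> (matrix_inv B' *v X) = t \<bullet> (matrix_inv B *v X) / k"
proof -
  let ?u = "transpose S *v (matrix_inv B' *v X)"
  have "S *v (B *v ?u) = X"
    using matrix_inv_cancel(1)[OF B', of X] by (simp add: BS matrix_vector_mul_assoc matrix_mul_assoc)
  then have "S *v (B *v (k *\<^sub>R ?u)) = S *v X"
    using X by (simp add: matrix_vector_mult_scaleR)
  then have "S *v (B *v (k *\<^sub>R ?u) - X) = 0"
    by (simp add: matrix_vector_mult_diff_distrib)
  then have "B *v (k *\<^sub>R ?u) = X"
    using S by fastforce
  then have "k *\<^sub>R ?u = matrix_inv B *v X"
    using matrix_inv_cancel(2)[OF B] by metis
  then have "k * (t \<bullet> ?u) = t \<bullet> (matrix_inv B *v X)"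
    by (metis inner_scaleR_right)
  moreover have "t \<bullet> ?u = (S *v t) \<bullet> (matrix_inv B' *v X)"
    by (simp add: inner_vector_matrix)
  ultimately show ?thesis
    using k by (simp add: field_simps)
qed

section \<open>Transition matrices of tractors\<close>

lemma chart_change_mult:
  fixes c c' :: "('p, 'm::finite) chart" and v :: "real^('m option)"
  defines "\<kappa> \<equiv> \<lambda>x. \<bar>det (jacobian c c' x)\<bar> powr (- 1 / (real CARD('m) + 1))"
  shows "(chart_change c c' x *v v) $ Some a = \<kappa> x * (jacobian c c' x *v (\<chi> b. v $ Some b)) $ a"
    and "(chart_change c c' x *v v) $ None = \<kappa> x * v $ None"
  unfolding chart_change_def matrix_vector_mult_def \<kappa>_def
  by (simp_all add: sum_UNIV_option sum_distrib_left mult_ac)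

lemma scale_change_mult:
  fixes v :: "real^('m::finite option)"
  shows "(scale_change u *v v) $ Some a = v $ Some a"
    and "(scale_change u *v v) $ None = v $ None - (\<Sum>b\<in>UNIV. u $ b * v $ Some b)"
  unfolding scale_change_def matrix_vector_mult_def
  by (simp_all add: sum_UNIV_option sum_negf if_distrib[of "\<lambda>x. x * _"] cong: if_cong)

lemma option_vec_eq_iff: "v = w \<longleftrightarrow> (\<forall>a. v $ Some a = w $ Some a) \<and> v $ None = w $ None"
  for v w :: "'a^('m::finite option)"
  by (auto simp: vec_eq_iff) (metis option.exhaust)

section \<open>The tractor connection in a chart\<close>

text \<open>\<open>\<tau>\<close> is the trace term that weight -1 adds to the covariant derivative
  in both slots.\<close>

lemma tractor_conn_matrix_nth:
  fixes G :: "'m::finite local_connection"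
  defines "\<tau> \<equiv> \<lambda>x c. - (\<Sum>d\<in>UNIV. G x c d d) / (real CARD('m) + 1)"
  shows "tractor_conn_matrix G x c $ Some a $ Some b = G x c b a + (if a = b then \<tau> x c else 0)"
    and "tractor_conn_matrix G x c $ Some a $ None = (if c = a then 1 else 0)"
    and "tractor_conn_matrix G x c $ None $ Some b = - schouten G x c b"
    and "tractor_conn_matrix G x c $ None $ None = \<tau> x c"
  unfolding tractor_conn_matrix_def tractor_deriv_def cov_vector_def cov_density_def partial_def \<tau>_def
  by (auto simp: axis_def if_distrib[of "\<lambda>x. _ * x"] cong: if_cong)

text \<open>The matrix form of \<nabla> X = W. The extra multiple of X is a weight term; it drops
  out when paired with a covector whose X-slot is zero.\<close>

lemma tractor_conn_matrix_canonical:
  fixes G :: "'m::finite local_connection"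
  shows "tractor_conn_matrix G x c *v axis None 1 =
    axis (Some c) 1 + (- (\<Sum>d\<in>UNIV. G x c d d) / (real CARD('m) + 1)) *\<^sub>R axis None 1"
  unfolding option_vec_eq_iff
  by (auto simp: matrix_vector_mult_def sum_UNIV_option tractor_conn_matrix_nth) (auto simp: axis_def)

lemma partial_vec_nth:
  assumes "f differentiable (at x)"
  shows "partial a (\<lambda>y. f y $ i) x = partial a f x $ i"
proof -
  have "((\<lambda>y. f y $ i) has_derivative (\<lambda>v. frechet_derivative f (at x) v $ i)) (at x)"
    using bounded_linear.has_derivative[OF bounded_linear_vec_nth] assms frechet_derivative_works by blast
  then show ?thesis
    unfolding partial_def using frechet_derivative_at by metis
qed

lemma tractor_deriv_eq:
  fixes G :: "'m::finite local_connection"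
  assumes "T differentiable (at x)"
  shows "tractor_deriv G T x c = partial c T x + tractor_conn_matrix G x c *v T x"
  unfolding option_vec_eq_iff
  by (simp add: tractor_deriv_def cov_vector_def cov_density_def partial_vec_nth[OF assms]
      matrix_vector_mult_def sum_UNIV_option tractor_conn_matrix_nth sum.distrib distrib_right
      sum_negf if_distrib[of "\<lambda>x. x * _"] cong: if_cong)

lemma bounded_bilinear_matrix_vector: "bounded_bilinear ((*v) :: real^'n^'m \<Rightarrow> _)"
  by (rule bilinear_conv_bounded_bilinear[THEN iffD1])
    (auto simp: bilinear_def matrix_vector_mult_add_rdistrib matrix_vector_right_distrib
      scaleR_matrix_vector_assoc matrix_vector_mult_scaleR intro!: linearI)

text \<open>\<open>A\<close> is the connection matrix in the direction \<open>a\<close>: the last hypothesis says that \<open>H\<close> is parallel.\<close>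

lemma partial_inverse_parallel:
  fixes H :: "real^'m \<Rightarrow> real^'n^'n" and \<phi> :: "real^'m::finite \<Rightarrow> real^'n::finite"
  assumes U: "open U" "x \<in> U" and H: "H differentiable (at x)" and \<phi>: "\<phi> differentiable (at x)"
    and eq: "\<And>y. y \<in> U \<Longrightarrow> H y *v \<phi> y = X" and inv: "invertible (H x)"
    and par: "partial a H x + A ** H x + H x ** transpose A = 0"
  shows "partial a \<phi> x = matrix_inv (H x) *v (A *v X) + transpose A *v \<phi> x"
proof -
  have "((\<lambda>y. H y *v \<phi> y) has_derivative
      (\<lambda>v. H x *v frechet_derivative \<phi> (at x) v + frechet_derivative H (at x) v *v \<phi> x)) (at x)"
    by (rule bounded_bilinear.FDERIV[OF bounded_bilinear_matrix_vector
          H[unfolded frechet_derivative_works] \<phi>[unfolded frechet_derivative_works]])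
  then have "((\<lambda>y. X) has_derivative
      (\<lambda>v. H x *v frechet_derivative \<phi> (at x) v + frechet_derivative H (at x) v *v \<phi> x)) (at x)"
    by (rule has_derivative_transform_within_open[OF _ U]) (rule eq)
  then have "(\<lambda>v. H x *v frechet_derivative \<phi> (at x) v + frechet_derivative H (at x) v *v \<phi> x) = (\<lambda>v. 0)"
    using has_derivative_const has_derivative_unique by blast
  then have 1: "H x *v partial a \<phi> x + partial a H x *v \<phi> x = 0"
    unfolding partial_def by meson
  \<comment> \<open>Evaluated on \<open>\<phi> x\<close>, parallelism trades the derivative of
    \<open>H\<close> for \<open>A\<close>, and \<open>H x *v \<phi> x\<close> is
    \<open>X\<close>.\<close>
  have "partial a H x *v \<phi> x + (A ** H x) *v \<phi> x + (H x ** transpose A) *v \<phi> x = 0"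
    using par by (metis matrix_vector_mult_add_rdistrib matrix_vector_mult_0)
  then have "partial a H x *v \<phi> x = - (A *v X) - H x *v (transpose A *v \<phi> x)"
    using eq[OF U(2)] by (simp add: matrix_vector_mul_assoc[symmetric] algebra_simps add_eq_0_iff)
  with 1 have "H x *v partial a \<phi> x = A *v X + H x *v (transpose A *v \<phi> x)"
    by (simp add: algebra_simps)
  then have "matrix_inv (H x) *v (H x *v partial a \<phi> x) =
      matrix_inv (H x) *v (A *v X) + matrix_inv (H x) *v (H x *v (transpose A *v \<phi> x))"
    by (simp add: matrix_vector_right_distrib)
  then show ?thesis
    by (simp add: matrix_inv_cancel[OF inv])
qed

lemma partial_inner:
  assumes "f differentiable (at x)" "g differentiable (at x)"
  shows "partial a (\<lambda>y. f y \<bullet> g y) x = f x \<bullet> partial a g x + partial a f x \<bullet> g x"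
proof -
  have "((\<lambda>y. f y \<bullet> g y) has_derivative
      (\<lambda>v. f x \<bullet> frechet_derivative g (at x) v + frechet_derivative f (at x) v \<bullet> g x)) (at x)"
    using has_derivative_inner assms frechet_derivative_works by blast
  then show ?thesis
    unfolding partial_def by (metis (mono_tags, lifting) frechet_derivative_at)
qed

lemma tractor_pairing_eq_inner:
  "tractor_pairing \<Psi> S T \<Gamma> c x = S \<Gamma> c x \<bullet> (\<Psi> \<Gamma> c x *v T \<Gamma> c x)"
  unfolding tractor_pairing_def inner_vec_def matrix_vector_mult_def
  by (simp add: sum_distrib_left mult_ac)

text \<open>The zero one-form puts the base connection into its own class. Every scale is then
  compared directly with this one connection.\<close>

lemma projective_structure_base:
  assumes "projective_structure A PS"
  obtains \<Gamma> where "\<Gamma> \<in> PS" "\<And>\<Gamma>'. \<Gamma>' \<in> PS \<Longrightarrow> \<exists>\<Upsilon>. projective_change A \<Upsilon> \<Gamma> \<Gamma>'"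
proof -
  obtain \<Gamma> where \<Gamma>: "affine_connection A \<Gamma>" "torsion_free A \<Gamma>"
    and PS: "PS = {\<Gamma>'. affine_connection A \<Gamma>' \<and> torsion_free A \<Gamma>' \<and> (\<exists>\<Upsilon>. projective_change A \<Upsilon> \<Gamma> \<Gamma>')}"
    using assms unfolding projective_structure_def by blast
  have "projective_change A (\<lambda>_ _. 0) \<Gamma> \<Gamma>"
    unfolding projective_change_def one_form_def smooth_on_def by (simp add: ck_on_const)
  then have "\<Gamma> \<in> PS" using \<Gamma> PS by blast
  then show ?thesis using that PS by blast
qed

section \<open>Geometry of a null parallel tractor\<close>

text \<open>All differential computations take place in the fixed scale \<open>\<Gamma>\<close>;
  other scales are related to it by \<open>scale_base\<close>.\<close>

locale null_parallel_tractor =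
  fixes A :: "('p::topological_space, 'm::finite) chart set"
    and PS :: "('p, 'm) connection set"
    and H :: "('p, 'm) tractor2" and I :: "('p, 'm) tractor1"
    and \<Gamma> :: "('p, 'm) connection"
  assumes atlas: "smooth_atlas A"
    and H_field: "symmetric_tractor_field A PS H" and H_nondeg: "nondegenerate_tractor2 A PS H"
    and H_parallel: "parallel_tractor2 A PS H"
    and I_field: "tractor_field A PS I" and I_nonzero: "nowhere_vanishing A PS I"
    and I_parallel: "parallel_tractor A PS I"
    and I_null: "zero_locus A PS (tractor_pairing (tractor2_inverse H) I I) = UNIV"
    and scale: "\<Gamma> \<in> PS" and scale_base: "\<And>\<Gamma>'. \<Gamma>' \<in> PS \<Longrightarrow> \<exists>\<Upsilon>. projective_change A \<Upsilon> \<Gamma> \<Gamma>'"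
begin

section \<open>The scalar fields and lowered tractors, and their smoothness\<close>

abbreviation "X \<equiv> axis None (1::real) :: real^('m option)"

text \<open>\<open>dual_X\<close> and \<open>dual_I\<close> are the covectors \<Phi>(X, .) and
  \<Phi>(I, .). Keeping them as vectors reduces differentiating the inverse of \<open>H\<close> to
  differentiating solutions of linear systems.\<close>

definition "dual_X \<Gamma>' c x = matrix_inv (H \<Gamma>' c x) *v X"
definition "\<sigma> \<Gamma>' c x = I \<Gamma>' c x \<bullet> dual_X \<Gamma>' c x"
definition "lam \<Gamma>' c x = X \<bullet> dual_X \<Gamma>' c x"
definition "dual_I c x = matrix_inv (H \<Gamma> c x) *v I \<Gamma> c x"

lemma charts: "c \<in> A \<Longrightarrow> is_chart c" and compat: "c \<in> A \<Longrightarrow> c' \<in> A \<Longrightarrow> compatible c c'"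
  using atlas unfolding smooth_atlas_def by auto

lemma open_image: "c \<in> A \<Longrightarrow> open (chart_image c)"
  using charts is_chart_def by blast

lemma coord_in_image: "p \<in> chart_dom c \<Longrightarrow> coord c p \<in> chart_image c"
  unfolding chart_image_def by blast

lemma chart_at: obtains c where "c \<in> A" "p \<in> chart_dom c"
  using atlas unfolding smooth_atlas_def by blast

lemma H_invertible: "\<Gamma>' \<in> PS \<Longrightarrow> c \<in> A \<Longrightarrow> x \<in> chart_image c \<Longrightarrow> invertible (H \<Gamma>' c x)"
  using H_nondeg unfolding nondegenerate_tractor2_def by blast

lemma H_symmetric: "c \<in> A \<Longrightarrow> x \<in> chart_image c \<Longrightarrow> transpose (H \<Gamma> c x) = H \<Gamma> c x"
  using H_field scale unfolding symmetric_tractor_field_def by blast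

lemma H_dual_X: "c \<in> A \<Longrightarrow> x \<in> chart_image c \<Longrightarrow> H \<Gamma> c x *v dual_X \<Gamma> c x = X"
  unfolding dual_X_def by (simp add: matrix_inv_cancel H_invertible scale)

lemma H_dual_I: "c \<in> A \<Longrightarrow> x \<in> chart_image c \<Longrightarrow> H \<Gamma> c x *v dual_I c x = I \<Gamma> c x"
  unfolding dual_I_def by (simp add: matrix_inv_cancel H_invertible scale)

lemma smooth_I: "c \<in> A \<Longrightarrow> smooth_on (chart_image c) (I \<Gamma> c)"
  using I_field scale unfolding tractor_field_def by blast

lemma smooth_H: "c \<in> A \<Longrightarrow> smooth_on (chart_image c) (H \<Gamma> c)"
  using H_field scale unfolding symmetric_tractor_field_def by blast

text \<open>By \<open>H_dual_X\<close> the covector solves a linear system with smooth invertible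
  matrix and constant right-hand side, so Cramer's rule applies.\<close>

lemma smooth_dual_X:
  assumes "c \<in> A"
  shows "smooth_on (chart_image c) (dual_X \<Gamma> c)"
  unfolding smooth_on_def
proof
  fix k
  have "ck_on k (chart_image c) (H \<Gamma> c)"
    using smooth_H[OF assms] unfolding smooth_on_def by blast
  then have "ck_on k (chart_image c) (\<lambda>x. H \<Gamma> c x $ i $ j)" for i j
    by (rule ck_on_vec_nth[OF open_image[OF assms] ck_on_vec_nth[OF open_image[OF assms]]])
  then show "ck_on k (chart_image c) (dual_X \<Gamma> c)"
    using ck_on_linear_solution[OF open_image[OF assms], of k "H \<Gamma> c" "\<lambda>_. X" "dual_X \<Gamma> c"]
      H_dual_X[OF assms] H_invertible[OF scale assms] by (simp add: ck_on_const invertible_det_nz)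
qed

lemma smooth_\<sigma>: "c \<in> A \<Longrightarrow> smooth_on (chart_image c) (\<sigma> \<Gamma> c)"
  using ck_on_bilinear[OF bounded_bilinear_inner open_image, of c _ "I \<Gamma> c" "dual_X \<Gamma> c"]
    smooth_I smooth_dual_X unfolding smooth_on_def \<sigma>_def[abs_def] by blast

lemma smooth_lam: "c \<in> A \<Longrightarrow> smooth_on (chart_image c) (lam \<Gamma> c)"
  using ck_on_bounded_linear[OF bounded_linear_inner_right open_image, of c _ "dual_X \<Gamma> c"]
    smooth_dual_X unfolding smooth_on_def lam_def[abs_def] by blast

lemma differentiable_fields:
  assumes "c \<in> A" "x \<in> chart_image c"
  shows "I \<Gamma> c differentiable (at x)" "H \<Gamma> c differentiable (at x)" "dual_X \<Gamma> c differentiable (at x)"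
  unfolding frechet_derivative_works
  by (rule smooth_on_has_derivative[OF _ assms(2)], rule smooth_I smooth_H smooth_dual_X, rule assms(1))+

section \<open>First derivatives of \<sigma> and \<lambda>\<close>

lemma partial_I:
  assumes "c \<in> A" "x \<in> chart_image c"
  shows "partial a (I \<Gamma> c) x = - (tractor_conn_matrix (\<Gamma> c) x a *v I \<Gamma> c x)"
  using I_parallel scale assms tractor_deriv_eq[OF differentiable_fields(1)[OF assms], of "\<Gamma> c" a]
  unfolding parallel_tractor_def by (metis add_eq_0_iff2)

lemma partial_dual_X:
  assumes "c \<in> A" "x \<in> chart_image c"
  shows "partial a (dual_X \<Gamma> c) x = matrix_inv (H \<Gamma> c x) *v (tractor_conn_matrix (\<Gamma> c) x a *v X)
    + transpose (tractor_conn_matrix (\<Gamma> c) x a) *v dual_X \<Gamma> c x"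
proof (rule partial_inverse_parallel[OF open_image[OF assms(1)] assms(2)])
  show "partial a (H \<Gamma> c) x + tractor_conn_matrix (\<Gamma> c) x a ** H \<Gamma> c x
      + H \<Gamma> c x ** transpose (tractor_conn_matrix (\<Gamma> c) x a) = 0"
    using H_parallel scale assms unfolding parallel_tractor2_def tractor2_deriv_def by blast
qed (use differentiable_fields assms H_dual_X H_invertible scale in auto)

text \<open>With A the connection matrix, the derivative of \<open>I\<close> contributes the pairing
  of - A I with \<open>dual_X\<close>, which cancels against the transposed term of
  \<open>partial_dual_X\<close>. What remains is \<Phi>(I, A X).\<close>

lemma partial_\<sigma>_eq:
  assumes "c \<in> A" "x \<in> chart_image c"
  shows "partial a (\<sigma> \<Gamma> c) x = dual_I c x \<bullet> (tractor_conn_matrix (\<Gamma> c) x a *v X)"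
  unfolding \<sigma>_def[abs_def] partial_inner[OF differentiable_fields(1,3)[OF assms]]
    partial_I[OF assms] partial_dual_X[OF assms]
  by (simp add: inner_add_right inner_vector_matrix dual_I_def
      inner_matrix_inv_symmetric[OF H_invertible[OF scale assms] H_symmetric[OF assms]])

text \<open>As X has constant components, only \<open>dual_X\<close> is differentiated and nothing
  cancels. Both resulting terms equal \<Phi>(X, A X) by symmetry, whence the factor 2.\<close>

lemma partial_lam_eq:
  assumes "c \<in> A" "x \<in> chart_image c"
  shows "partial a (lam \<Gamma> c) x = 2 * (dual_X \<Gamma> c x \<bullet> (tractor_conn_matrix (\<Gamma> c) x a *v X))"
proof -
  let ?M = "tractor_conn_matrix (\<Gamma> c) x a"
  have "partial a (lam \<Gamma> c) x = X \<bullet> partial a (dual_X \<Gamma> c) x"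
    unfolding lam_def[abs_def] partial_inner[OF differentiable_const differentiable_fields(3)[OF assms]]
    by (simp add: partial_def)
  also have "\<dots> = (matrix_inv (H \<Gamma> c x) *v X) \<bullet> (?M *v X) + (?M *v X) \<bullet> dual_X \<Gamma> c x"
    by (simp add: partial_dual_X[OF assms] inner_add_right inner_vector_matrix
        inner_matrix_inv_symmetric[OF H_invertible[OF scale assms] H_symmetric[OF assms]])
  finally show ?thesis
    by (simp add: dual_X_def inner_commute)
qed

lemma dual_I_None: "c \<in> A \<Longrightarrow> x \<in> chart_image c \<Longrightarrow> dual_I c x $ None = \<sigma> \<Gamma> c x"
  unfolding dual_I_def \<sigma>_def dual_X_def
  by (simp add: inner_matrix_inv_symmetric[OF H_invertible[OF scale] H_symmetric] inner_axis)

lemma dual_X_None: "dual_X \<Gamma> c x $ None = lam \<Gamma> c x"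
  unfolding lam_def by (simp add: inner_axis')

text \<open>The weight term of \<open>tractor_conn_matrix_canonical\<close> pairs with
  \<open>dual_I\<close> to a multiple of \<sigma>, which vanishes here. The same happens for
  \<lambda> and \<open>dual_X\<close> in the next lemma.\<close>

lemma partial_\<sigma>_at_zero:
  assumes "c \<in> A" "x \<in> chart_image c" "\<sigma> \<Gamma> c x = 0"
  shows "partial a (\<sigma> \<Gamma> c) x = dual_I c x $ Some a"
  using assms dual_I_None[OF assms(1,2)]
  by (simp add: partial_\<sigma>_eq tractor_conn_matrix_canonical inner_diff_right inner_axis)

lemma partial_lam_at_zero:
  assumes "c \<in> A" "x \<in> chart_image c" "lam \<Gamma> c x = 0"
  shows "partial a (lam \<Gamma> c) x = 2 * dual_X \<Gamma> c x $ Some a"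
  using assms dual_X_None[of c x]
  by (simp add: partial_lam_eq tractor_conn_matrix_canonical inner_diff_right inner_axis)

lemma I_at_nonzero: "c \<in> A \<Longrightarrow> x \<in> chart_image c \<Longrightarrow> I \<Gamma> c x \<noteq> 0"
  using I_nonzero scale unfolding nowhere_vanishing_def by blast

text \<open>\<open>H\<close> maps \<open>dual_I\<close> to the non-zero tractor \<open>I\<close>, so
  \<open>dual_I\<close> is non-zero. Its X-slot is \<sigma> = 0, hence one of the other slots, which
  are the partial derivatives of \<sigma>, is non-zero.\<close>

lemma d\<sigma>_nonzero:
  assumes "c \<in> A" "x \<in> chart_image c" "\<sigma> \<Gamma> c x = 0"
  obtains a where "partial a (\<sigma> \<Gamma> c) x \<noteq> 0"
proof -
  have "dual_I c x \<noteq> 0"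
    using H_dual_I[OF assms(1,2)] I_at_nonzero[OF assms(1,2)] by (metis matrix_vector_mult_0_right)
  then show ?thesis
    using that partial_\<sigma>_at_zero[OF assms] dual_I_None[OF assms(1,2)] assms(3)
    by (auto simp: option_vec_eq_iff[of _ 0])
qed

text \<open>If every minor vanished, \<open>dual_I\<close> and \<open>dual_X\<close> would be
  dependent, and applying \<open>H\<close> would give a linear relation between \<open>I\<close> and
  X. The slot \<open>b\<close> kills the coefficient of \<open>I\<close> and then the X-slot kills
  that of X, against the choice of \<open>j\<close>.\<close>

lemma d\<sigma>_dlam_independent:
  assumes "c \<in> A" "x \<in> chart_image c" "\<sigma> \<Gamma> c x = 0" "lam \<Gamma> c x = 0"
    and proj: "I \<Gamma> c x $ Some b \<noteq> 0"
  obtains i j where "partial i (\<sigma> \<Gamma> c) x * partial j (lam \<Gamma> c) x \<noteq> partial j (\<sigma> \<Gamma> c) x * partial i (lam \<Gamma> c) x"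
proof -
  let ?u = "dual_I c x" and ?w = "dual_X \<Gamma> c x"
  obtain j where j: "?u $ Some j \<noteq> 0"
    using d\<sigma>_nonzero[OF assms(1-3)] partial_\<sigma>_at_zero[OF assms(1-3)] by metis
  have "\<exists>i. ?u $ Some i * ?w $ Some j \<noteq> ?u $ Some j * ?w $ Some i"
  proof (rule ccontr)
    assume "\<not> ?thesis"
    \<comment> \<open>The X-slots of the two covectors are \<sigma> and \<lambda>, both zero, so the
      vanishing minors give equality in all slots.\<close>
    then have "?u $ Some j *\<^sub>R ?w = ?w $ Some j *\<^sub>R ?u"
      using dual_I_None[OF assms(1,2)] dual_X_None[of c x] assms(3,4)
      by (simp add: option_vec_eq_iff mult.commute)
    then have "H \<Gamma> c x *v (?u $ Some j *\<^sub>R ?w) = H \<Gamma> c x *v (?w $ Some j *\<^sub>R ?u)"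
      by simp
    then have eq: "?u $ Some j *\<^sub>R X = ?w $ Some j *\<^sub>R I \<Gamma> c x"
      by (simp add: matrix_vector_mult_scaleR H_dual_X[OF assms(1,2)] H_dual_I[OF assms(1,2)])
    have "?w $ Some j = 0"
      using arg_cong[OF eq, of "\<lambda>v. v $ Some b"] proj by (simp add: axis_def)
    then show False
      using arg_cong[OF eq, of "\<lambda>v. v $ None"] j by (simp add: axis_def)
  qed
  then show ?thesis
    using that partial_\<sigma>_at_zero[OF assms(1-3)] partial_lam_at_zero[OF assms(1,2,4)] by auto
qed

text \<open>At a zero only the X-slot \<rho> of \<open>I\<close> enters the parallel equation for
  \<open>\<xi>\<close>, through the identity block of the connection matrix. So the derivative of
  \<open>\<xi>\<close> is -\<rho> times the identity, and \<open>\<xi>\<close> is injective near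
  \<open>x\<close>.\<close>

lemma isolated_zero_of_projection:
  assumes "c \<in> A" "x \<in> chart_image c" and zero: "\<And>a. I \<Gamma> c x $ Some a = 0"
  obtains W where "open W" "x \<in> W" "W \<subseteq> chart_image c"
    "\<And>y. y \<in> W \<Longrightarrow> (\<And>a. I \<Gamma> c y $ Some a = 0) \<Longrightarrow> y = x"
proof -
  let ?U = "chart_image c" and ?\<rho> = "I \<Gamma> c x $ None"
  define \<xi> where "\<xi> y = (\<chi> a. I \<Gamma> c y $ Some a)" for y
  have \<rho>: "?\<rho> \<noteq> 0"
    using I_at_nonzero[OF assms(1,2)] zero by (auto simp: option_vec_eq_iff[of _ 0])
  have "ck_on k ?U (\<lambda>y. \<xi> y $ a)" for k a
    using smooth_I[OF assms(1)] ck_on_vec_nth[OF open_image[OF assms(1)], of k "I \<Gamma> c"]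
    unfolding \<xi>_def smooth_on_def by simp
  then have sm: "smooth_on ?U \<xi>"
    unfolding smooth_on_def using ck_on_vec[OF open_image[OF assms(1)]] by blast
  note der = smooth_on_has_derivative[OF sm assms(2)]
  have par: "partial a \<xi> x = - ?\<rho> *\<^sub>R axis a 1" for a
  proof -
    have "partial a \<xi> x $ b = - (if a = b then ?\<rho> else 0)" for b
    proof -
      have "partial a \<xi> x $ b = partial a (\<lambda>y. \<xi> y $ b) x"
        using partial_vec_nth der unfolding differentiable_def by metis
      also have "\<dots> = partial a (I \<Gamma> c) x $ Some b"
        unfolding \<xi>_def using partial_vec_nth[OF differentiable_fields(1)[OF assms(1,2)]] by simp
      also have "\<dots> = - (if a = b then ?\<rho> else 0)"
        unfolding partial_I[OF assms(1,2)]
        by (simp add: matrix_vector_mult_def sum_UNIV_option tractor_conn_matrix_nth zero)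
      finally show ?thesis .
    qed
    then show ?thesis by (auto simp: vec_eq_iff axis_def)
  qed
  have "frechet_derivative \<xi> (at x) v = - ?\<rho> *\<^sub>R v" for v
  proof -
    have lin: "linear (frechet_derivative \<xi> (at x))"
      using der has_derivative_linear by blast
    have "frechet_derivative \<xi> (at x) v = frechet_derivative \<xi> (at x) (\<Sum>a\<in>UNIV. v $ a *\<^sub>R axis a 1)"
      using basis_expansion[of v] by (simp add: scalar_mult_eq_scaleR)
    also have "\<dots> = (\<Sum>a\<in>UNIV. v $ a *\<^sub>R partial a \<xi> x)"
      unfolding partial_def by (simp add: linear_sum[OF lin] linear_cmul[OF lin])
    also have "\<dots> = - ?\<rho> *\<^sub>R (\<Sum>a\<in>UNIV. v $ a *\<^sub>R axis a 1)"
      by (simp add: par scaleR_sum_right mult.commute sum_negf)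
    finally show ?thesis
      using basis_expansion[of v] by (simp add: scalar_mult_eq_scaleR)
  qed
  then have "v = 0" if "frechet_derivative \<xi> (at x) v = 0" for v
    using that \<rho> by simp
  then obtain W V g where W: "open W" "W \<subseteq> ?U" "x \<in> W" "homeomorphism W V \<xi> g"
    using smooth_inverse_function[OF open_image[OF assms(1)] sm assms(2)] by metis
  have "y = x" if "y \<in> W" "\<And>a. I \<Gamma> c y $ Some a = 0" for y
  proof -
    have "\<xi> y = \<xi> x" using that(2) zero unfolding \<xi>_def by simp
    then show ?thesis
      using W(3,4) that(1) unfolding homeomorphism_def by metis
  qed
  then show ?thesis using that W by blast
qed

section \<open>Independence of the chart and of the scale\<close>

text \<open>Here \<open>k\<close> is the factor by which densities of weight -1 change, so \<sigma>
  and \<lambda>, of weights 1 and 2, are divided by \<open>k\<close> and its square. Positivity of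
  \<open>k\<close> makes their signs well defined.\<close>

lemma chart_change_fields:
  assumes "c \<in> A" "c' \<in> A" "p \<in> chart_dom c" "p \<in> chart_dom c'"
  defines "x \<equiv> coord c p" and "y \<equiv> coord c' p"
  obtains k where "k > 0" "\<sigma> \<Gamma> c' y = \<sigma> \<Gamma> c x / k" "lam \<Gamma> c' y = lam \<Gamma> c x / k\<^sup>2"
    "(\<forall>a. I \<Gamma> c' y $ Some a = 0) \<longleftrightarrow> (\<forall>a. I \<Gamma> c x $ Some a = 0)"
proof -
  have x: "x \<in> overlap c c'" "x \<in> chart_image c" and y: "y = transition c c' x" "y \<in> chart_image c'"
    using assms transition_coord[OF charts[OF assms(1)]] unfolding overlap_def chart_image_def by auto
  define k where "k = \<bar>det (jacobian c c' x)\<bar> powr (- 1 / (real CARD('m) + 1))"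
  have det: "det (jacobian c c' x) \<noteq> 0"
    using det_jacobian_nonzero assms(1,2) charts compat x(1) by blast
  then have k: "k > 0" unfolding k_def by simp
  let ?S = "chart_change c c' x"
  have J: "v = 0" if "jacobian c c' x *v v = 0" for v
    using that det invertible_det_nz invertible_left_inverse matrix_left_invertible_ker by blast
  have S: "(?S *v v) $ Some a = k * (jacobian c c' x *v (\<chi> b. v $ Some b)) $ a"
    "(?S *v v) $ None = k * v $ None" for v a
    unfolding k_def by (rule chart_change_mult)+
  have S_zero: "(\<forall>a. (?S *v v) $ Some a = 0) \<longleftrightarrow> (\<forall>a. v $ Some a = 0)" for v
  proof
    assume "\<forall>a. (?S *v v) $ Some a = 0"
    then have "jacobian c c' x *v (\<chi> b. v $ Some b) = 0"
      using S k by (simp add: vec_eq_iff)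
    then have "(\<chi> b. v $ Some b) = 0" by (rule J)
    then show "\<forall>a. v $ Some a = 0" by (simp add: vec_eq_iff)
  next
    assume "\<forall>a. v $ Some a = 0"
    then have "(\<chi> b. v $ Some b) = 0" by (simp add: vec_eq_iff)
    then show "\<forall>a. (?S *v v) $ Some a = 0" using S by simp
  qed
  have S_inj: "v = 0" if "?S *v v = 0" for v
  proof -
    have "\<forall>a. v $ Some a = 0" using S_zero[of v] that by simp
    moreover have "v $ None = 0" using S(2)[of v] that k by simp
    ultimately show ?thesis by (simp add: option_vec_eq_iff)
  qed
  have "(\<chi> b. X $ Some b) = (0 :: real^'m)"
    by (simp add: vec_eq_iff axis_def)
  then have SX: "?S *v X = k *\<^sub>R X"
    using S[of X] by (simp add: option_vec_eq_iff axis_def)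
  have I: "I \<Gamma> c' y = ?S *v I \<Gamma> c x"
    using I_field scale assms(1,2) x(1) y(1) unfolding tractor_field_def by blast
  have H: "H \<Gamma> c' y = ?S ** H \<Gamma> c x ** transpose ?S"
    using H_field scale assms(1,2) x(1) y(1) unfolding symmetric_tractor_field_def by blast
  have tr: "(?S *v t) \<bullet> dual_X \<Gamma> c' y = t \<bullet> dual_X \<Gamma> c x / k" for t
    unfolding dual_X_def using H_invertible[OF scale] assms(1,2) x(2) y(2) k
    by (intro inverse_pairing_transform[OF _ _ H S_inj SX]) auto
  show ?thesis
  proof (rule that[OF k])
    show "\<sigma> \<Gamma> c' y = \<sigma> \<Gamma> c x / k"
      unfolding \<sigma>_def I tr ..
    \<comment> \<open>Taking \<open>t\<close> to be X in \<open>tr\<close>, the relation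
      \<open>SX\<close> yields the second factor \<open>k\<close>.\<close>
    have "k * lam \<Gamma> c' y = lam \<Gamma> c x / k"
      using tr[of X] unfolding lam_def SX by simp
    then show "lam \<Gamma> c' y = lam \<Gamma> c x / k\<^sup>2"
      using k by (simp add: field_simps power2_eq_square)
  qed (simp add: I S_zero)
qed

text \<open>A change of scale is unipotent: it fixes X and the W-slots and alters only the X-slot.
  Hence \<open>inverse_pairing_transform\<close> applies with eigenvalue 1.\<close>

lemma scale_change_fields:
  assumes "c \<in> A" "x \<in> chart_image c" "\<Gamma>' \<in> PS"
  shows "\<sigma> \<Gamma>' c x = \<sigma> \<Gamma> c x" "lam \<Gamma>' c x = lam \<Gamma> c x" "I \<Gamma>' c x $ Some a = I \<Gamma> c x $ Some a"
proof -
  obtain \<Upsilon> where \<Upsilon>: "projective_change A \<Upsilon> \<Gamma> \<Gamma>'"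
    using scale_base assms(3) by blast
  let ?S = "scale_change (\<Upsilon> c x)"
  have S_inj: "v = 0" if "?S *v v = 0" for v
  proof -
    have "v $ Some a = 0" for a
      using scale_change_mult(1)[of "\<Upsilon> c x" v a] that by simp
    moreover from this have "v $ None = 0"
      using scale_change_mult(2)[of "\<Upsilon> c x" v] that by simp
    ultimately show ?thesis by (simp add: option_vec_eq_iff)
  qed
  have SX: "?S *v X = 1 *\<^sub>R X"
    by (simp add: option_vec_eq_iff scale_change_mult) (simp add: axis_def)
  have I: "I \<Gamma>' c x = ?S *v I \<Gamma> c x"
    using I_field scale assms \<Upsilon> unfolding tractor_field_def by blast
  have H: "H \<Gamma>' c x = ?S ** H \<Gamma> c x ** transpose ?S"
    using H_field scale assms \<Upsilon> unfolding symmetric_tractor_field_def by blast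
  have tr: "(?S *v t) \<bullet> dual_X \<Gamma>' c x = t \<bullet> dual_X \<Gamma> c x / 1" for t
    unfolding dual_X_def using H_invertible scale assms
    by (intro inverse_pairing_transform[OF _ _ H S_inj SX]) auto
  show "\<sigma> \<Gamma>' c x = \<sigma> \<Gamma> c x"
    unfolding \<sigma>_def I tr by simp
  show "lam \<Gamma>' c x = lam \<Gamma> c x"
    using tr[of X] unfolding lam_def SX by simp
  show "I \<Gamma>' c x $ Some a = I \<Gamma> c x $ Some a"
    unfolding I by (rule scale_change_mult)
qed

text \<open>\<open>points_where\<close> quantifies over all scales and charts. For a condition
  invariant under positive rescaling, one chart around the point and the scale
  \<open>\<Gamma>\<close> decide it.\<close>

lemma points_where_\<sigma>:
  assumes "c \<in> A" "p \<in> chart_dom c" and Q: "\<And>t k. k > 0 \<Longrightarrow> Q (t / k) \<longleftrightarrow> Q t"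
  shows "p \<in> points_where A PS \<sigma> Q \<longleftrightarrow> Q (\<sigma> \<Gamma> c (coord c p))"
proof
  assume Qp: "Q (\<sigma> \<Gamma> c (coord c p))"
  have "Q (\<sigma> \<Gamma>' c' (coord c' p))" if "\<Gamma>' \<in> PS" "c' \<in> A" "p \<in> chart_dom c'" for \<Gamma>' c'
    using chart_change_fields[OF assms(1) that(2) assms(2) that(3)] Q Qp
      scale_change_fields(1)[OF that(2) coord_in_image[OF that(3)] that(1)] by metis
  then show "p \<in> points_where A PS \<sigma> Q" unfolding points_where_def by blast
qed (use assms scale in \<open>auto simp: points_where_def\<close>)

lemma points_where_lam:
  assumes "c \<in> A" "p \<in> chart_dom c" and Q: "\<And>t k. k > 0 \<Longrightarrow> Q (t / k) \<longleftrightarrow> Q t"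
  shows "p \<in> points_where A PS lam Q \<longleftrightarrow> Q (lam \<Gamma> c (coord c p))"
proof
  assume Qp: "Q (lam \<Gamma> c (coord c p))"
  have "Q (lam \<Gamma>' c' (coord c' p))" if c': "\<Gamma>' \<in> PS" "c' \<in> A" "p \<in> chart_dom c'" for \<Gamma>' c'
  proof -
    obtain k :: real where "k > 0" "lam \<Gamma> c' (coord c' p) = lam \<Gamma> c (coord c p) / k\<^sup>2"
      using chart_change_fields[OF assms(1) c'(2) assms(2) c'(3)] by metis
    then show ?thesis
      using Q[of "k\<^sup>2"] Qp scale_change_fields(2)[OF c'(2) coord_in_image[OF c'(3)] c'(1)] by simp
  qed
  then show "p \<in> points_where A PS lam Q" unfolding points_where_def by blast
qed (use assms scale in \<open>auto simp: points_where_def\<close>)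

lemma zero_locus_projection:
  assumes "c \<in> A" "p \<in> chart_dom c"
  shows "p \<in> zero_locus A PS (tractor_projection I) \<longleftrightarrow> (\<forall>a. I \<Gamma> c (coord c p) $ Some a = 0)"
proof
  assume Qp: "\<forall>a. I \<Gamma> c (coord c p) $ Some a = 0"
  have "I \<Gamma>' c' (coord c' p) $ Some a = 0" if "\<Gamma>' \<in> PS" "c' \<in> A" "p \<in> chart_dom c'" for \<Gamma>' c' a
    using chart_change_fields[OF assms(1) that(2) assms(2) that(3)] Qp
      scale_change_fields(3)[OF that(2) coord_in_image[OF that(3)] that(1)] by metis
  then show "p \<in> zero_locus A PS (tractor_projection I)"
    unfolding zero_locus_def points_where_def tractor_projection_def by (auto simp: vec_eq_iff)
next
  assume "p \<in> zero_locus A PS (tractor_projection I)"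
  then have "tractor_projection I \<Gamma> c (coord c p) = 0"
    using assms scale unfolding zero_locus_def points_where_def by blast
  then show "\<forall>a. I \<Gamma> c (coord c p) $ Some a = 0"
    unfolding tractor_projection_def by (simp add: vec_eq_iff)
qed

text \<open>Here I = \<rho> X with \<rho> non-zero, so 0 = \<Phi>(I, I) = \<rho> \<sigma>, and then
  0 = \<sigma> = \<rho> \<lambda>.\<close>

lemma zero_of_projection_imp:
  assumes "c \<in> A" "p \<in> chart_dom c" "\<And>a. I \<Gamma> c (coord c p) $ Some a = 0"
  shows "\<sigma> \<Gamma> c (coord c p) = 0" "lam \<Gamma> c (coord c p) = 0"
proof -
  let ?x = "coord c p" and ?\<rho> = "I \<Gamma> c (coord c p) $ None"
  have I: "I \<Gamma> c ?x = ?\<rho> *\<^sub>R X"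
    using assms(3) by (simp add: option_vec_eq_iff axis_def)
  then have \<rho>: "?\<rho> \<noteq> 0"
    using I_at_nonzero[OF assms(1) coord_in_image[OF assms(2)]] by auto
  have "tractor_pairing (tractor2_inverse H) I I \<Gamma> c ?x = 0"
    using I_null assms(1,2) scale unfolding zero_locus_def points_where_def by blast
  then have "I \<Gamma> c ?x \<bullet> (matrix_inv (H \<Gamma> c ?x) *v (?\<rho> *\<^sub>R X)) = 0"
    unfolding tractor_pairing_eq_inner tractor2_inverse_def using I by metis
  then show \<sigma>: "\<sigma> \<Gamma> c ?x = 0"
    using \<rho> by (simp add: matrix_vector_mult_scaleR \<sigma>_def dual_X_def)
  then have "(?\<rho> *\<^sub>R X) \<bullet> dual_X \<Gamma> c ?x = 0"
    unfolding \<sigma>_def using I by metis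
  then show "lam \<Gamma> c ?x = 0"
    using \<rho> by (simp add: lam_def)
qed

section \<open>From local equations to subsets of the manifold\<close>

lemma open_by_charts:
  assumes "\<And>c. c \<in> A \<Longrightarrow> open (W c)"
    and "\<And>c p. c \<in> A \<Longrightarrow> p \<in> chart_dom c \<Longrightarrow> p \<in> S \<longleftrightarrow> coord c p \<in> W c"
  shows "open S"
proof -
  have "S = (\<Union>c\<in>A. chart_dom c \<inter> coord c -` W c)"
  proof (rule set_eqI)
    fix p
    obtain c where "c \<in> A" "p \<in> chart_dom c" by (rule chart_at)
    then show "p \<in> S \<longleftrightarrow> p \<in> (\<Union>c\<in>A. chart_dom c \<inter> coord c -` W c)"
      using assms(2) by blast
  qed
  moreover have "open (chart_dom c \<inter> coord c -` W c)" if "c \<in> A" for c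
    using open_coord_preimage[OF charts assms(1)] that by blast
  ultimately show ?thesis
    by (simp add: open_UN)
qed

text \<open>The coordinate image of the part of M inside \<open>chart_dom c\<close>, read in the
  fixed scale.\<close>

definition "proj_nonzero c = {x \<in> chart_image c. \<exists>a. I \<Gamma> c x $ Some a \<noteq> 0}"

lemma proj_nonzero_sub: "proj_nonzero c \<subseteq> chart_image c"
  unfolding proj_nonzero_def by blast

lemma open_proj_nonzero:
  assumes "c \<in> A"
  shows "open (proj_nonzero c)"
proof -
  have "continuous_on (chart_image c) (\<lambda>x. I \<Gamma> c x $ Some a)" for a
    using smooth_on_continuous[OF smooth_I[OF assms]] by (intro continuous_intros)
  then have "open (chart_image c \<inter> (\<lambda>x. I \<Gamma> c x $ Some a) -` (- {0}))" for a
    using open_image[OF assms] by (intro continuous_open_preimage) auto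
  then have "open (\<Union>a. chart_image c \<inter> (\<lambda>x. I \<Gamma> c x $ Some a) -` (- {0}))"
    by blast
  moreover have "proj_nonzero c = (\<Union>a. chart_image c \<inter> (\<lambda>x. I \<Gamma> c x $ Some a) -` (- {0}))"
    unfolding proj_nonzero_def by auto
  ultimately show ?thesis by simp
qed

text \<open>One statement for three sets: each is cut out of the zero set of \<sigma> by an open
  condition \<open>W\<close>, which is \<open>proj_nonzero\<close> or a sign of \<lambda>. The
  differential of \<sigma> is non-zero at every zero of \<sigma>.\<close>

lemma embedded_in_zero_locus_\<sigma>:
  assumes "\<And>c. c \<in> A \<Longrightarrow> open (W c)" "\<And>c. c \<in> A \<Longrightarrow> W c \<subseteq> chart_image c"
    and S: "\<And>c p. c \<in> A \<Longrightarrow> p \<in> chart_dom c \<Longrightarrow> p \<in> S \<longleftrightarrow> \<sigma> \<Gamma> c (coord c p) = 0 \<and> coord c p \<in> W c"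
  shows "embedded_submanifold A (CARD('m) - 1) S"
  unfolding embedded_submanifold_def
proof
  fix p assume p: "p \<in> S"
  obtain c where c: "c \<in> A" "p \<in> chart_dom c" by (rule chart_at)
  have px: "\<sigma> \<Gamma> c (coord c p) = 0" "coord c p \<in> W c"
    using S[OF c] p by auto
  obtain a where "partial a (\<sigma> \<Gamma> c) (coord c p) \<noteq> 0"
    using d\<sigma>_nonzero[OF c(1) coord_in_image[OF c(2)] px(1)] by blast
  then show "\<exists>d\<in>maximal_atlas A. \<exists>K. p \<in> chart_dom d \<and> card K = CARD('m) - 1 \<and>
      coord d ` (chart_dom d \<inter> S) = chart_image d \<inter> {x. \<forall>i. i \<notin> K \<longrightarrow> x $ i = 0}"
    using smooth_on_subset[OF smooth_\<sigma>[OF c(1)] assms(2)[OF c(1)]] S[OF c(1)]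
    by (intro hypersurface_chart[OF atlas c px(2) assms(1,2)[OF c(1)]]) auto
qed

text \<open>On \<open>proj_nonzero\<close> the differentials of \<sigma> and \<lambda> are
  independent at common zeros, so the two functions serve together as coordinates.\<close>

lemma embedded_zero_locus_\<sigma>_lam:
  assumes S: "\<And>c p. c \<in> A \<Longrightarrow> p \<in> chart_dom c \<Longrightarrow>
    p \<in> S \<longleftrightarrow> \<sigma> \<Gamma> c (coord c p) = 0 \<and> lam \<Gamma> c (coord c p) = 0 \<and> coord c p \<in> proj_nonzero c"
  shows "embedded_submanifold A (CARD('m) - 2) S"
  unfolding embedded_submanifold_def
proof
  fix p assume p: "p \<in> S"
  obtain c where c: "c \<in> A" "p \<in> chart_dom c" by (rule chart_at)
  have px: "\<sigma> \<Gamma> c (coord c p) = 0" "lam \<Gamma> c (coord c p) = 0" "coord c p \<in> proj_nonzero c"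
    using S[OF c] p by auto
  obtain i j where "partial i (\<sigma> \<Gamma> c) (coord c p) * partial j (lam \<Gamma> c) (coord c p)
      \<noteq> partial j (\<sigma> \<Gamma> c) (coord c p) * partial i (lam \<Gamma> c) (coord c p)"
    using d\<sigma>_dlam_independent[OF c(1) coord_in_image[OF c(2)] px(1,2)] px(3)
    unfolding proj_nonzero_def by blast
  then show "\<exists>d\<in>maximal_atlas A. \<exists>K. p \<in> chart_dom d \<and> card K = CARD('m) - 2 \<and>
      coord d ` (chart_dom d \<inter> S) = chart_image d \<inter> {x. \<forall>i. i \<notin> K \<longrightarrow> x $ i = 0}"
    using S[OF c(1)]
    by (intro codimension_two_chart[OF atlas c px(3) open_proj_nonzero[OF c(1)] proj_nonzero_sub
          smooth_on_subset[OF smooth_\<sigma>[OF c(1)] proj_nonzero_sub] smooth_on_subset[OF smooth_lam[OF c(1)] proj_nonzero_sub]]) auto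
qed

lemma isolated_in_zero_locus_projection:
  assumes "p \<in> zero_locus A PS (tractor_projection I)"
  shows "p isolated_in zero_locus A PS (tractor_projection I)"
proof -
  obtain c where c: "c \<in> A" "p \<in> chart_dom c" by (rule chart_at)
  obtain W where W: "open W" "coord c p \<in> W" "W \<subseteq> chart_image c"
    "\<And>y. y \<in> W \<Longrightarrow> (\<And>a. I \<Gamma> c y $ Some a = 0) \<Longrightarrow> y = coord c p"
    using isolated_zero_of_projection[OF c(1) coord_in_image[OF c(2)]] assms zero_locus_projection[OF c]
    by metis
  have "q = p" if "q \<in> chart_dom c" "coord c q \<in> W" "q \<in> zero_locus A PS (tractor_projection I)" for q
    using W(4)[OF that(2)] zero_locus_projection[OF c(1) that(1)] that
      inj_onD[OF chart_inj[OF charts[OF c(1)]] _ that(1) c(2)] by blast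
  then have "(chart_dom c \<inter> coord c -` W) \<inter> zero_locus A PS (tractor_projection I) = {p}"
    using assms c(2) W(2) by blast
  then show ?thesis
    using isolated_inI[OF assms open_coord_preimage[OF charts[OF c(1)] W(1)]] by blast
qed

end

section \<open>Assembling the decomposition\<close>

lemma disjoint_decomposition_Cons:
  "disjoint_decomposition S (B # Bs) \<longleftrightarrow>
     S = B \<union> \<Union> (set Bs) \<and> (\<forall>C\<in>set Bs. B \<inter> C = {}) \<and> disjoint_decomposition (\<Union> (set Bs)) Bs"
proof -
  have "(\<forall>C\<in>set Bs. B \<inter> C = {}) \<longleftrightarrow> (\<forall>j < length Bs. B \<inter> Bs ! j = {})"
    by (metis in_set_conv_nth)
  then show ?thesis
    unfolding disjoint_decomposition_def
    by (auto simp: All_less_Suc2) (blast+)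
qed

theorem theorem3p1:
  fixes A :: "('p::{t2_space, second_countable_topology}, 'm::finite) chart set"
    and PS :: "('p, 'm) connection set"
    and H \<Phi> :: "('p, 'm) tractor2"
    and I X :: "('p, 'm) tractor1"
    and nn :: "('p, 'm, real^'m) tractor_components"
    and \<sigma> lam :: "('p, 'm, real) tractor_components"
    and n :: nat
    and M Zn \<O> \<Sigma> \<Sigma>neg \<Sigma>zero \<Sigma>pos :: "'p set"
  assumes "n \<ge> 1" and "CARD('m) = n + 1"
    and "smooth_atlas A"
    and "compact (UNIV :: 'p set)"
    and "projective_structure A PS"
    and "symmetric_tractor_field A PS H"
    and "nondegenerate_tractor2 A PS H"
    and "tractor2_signature A PS H 2 n"
    and "parallel_tractor2 A PS H"
    and "tractor_field A PS I"
    and "nowhere_vanishing A PS I"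
    and "parallel_tractor A PS I"
    and \<Phi>: "\<Phi> = tractor2_inverse H"
    and "zero_locus A PS (tractor_pairing \<Phi> I I) = UNIV"
    and X: "X = canonical_tractor"
    and nn: "nn = tractor_projection I"
    and \<sigma>: "\<sigma> = tractor_pairing \<Phi> I X"
    and lam: "lam = tractor_pairing \<Phi> X X"
    and Zn: "Zn = zero_locus A PS nn"
    and M: "M = - Zn"
    and \<O>: "\<O> = points_where A PS \<sigma> (\<lambda>v. v \<noteq> 0)"
    and \<Sigma>: "\<Sigma> = zero_locus A PS \<sigma> - Zn"
    and \<Sigma>neg: "\<Sigma>neg = zero_locus A PS \<sigma> \<inter> points_where A PS lam (\<lambda>v. v < 0)"
    and \<Sigma>pos: "\<Sigma>pos = zero_locus A PS \<sigma> \<inter> points_where A PS lam (\<lambda>v. v > 0)"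
    and \<Sigma>zero: "\<Sigma>zero = (zero_locus A PS \<sigma> \<inter> zero_locus A PS lam) - Zn"
  shows "(disjoint_decomposition UNIV [M, Zn] \<and> finite Zn \<and> (\<forall>p\<in>Zn. p isolated_in Zn))
    \<and> (disjoint_decomposition M [\<O>, \<Sigma>] \<and> open \<O> \<and>
         (\<Sigma> \<noteq> {} \<longrightarrow> embedded_hypersurface A \<Sigma>))
    \<and> (disjoint_decomposition \<Sigma> [\<Sigma>neg, \<Sigma>zero, \<Sigma>pos] \<and>
         smooth_submanifold A \<Sigma>neg \<and> smooth_submanifold A \<Sigma>zero \<and> smooth_submanifold A \<Sigma>pos)
    \<and> disjoint_decomposition UNIV [\<O>, \<Sigma>neg, \<Sigma>zero, \<Sigma>pos, Zn]"
proof -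
  obtain \<Gamma> where \<Gamma>: "\<Gamma> \<in> PS" "\<And>\<Gamma>'. \<Gamma>' \<in> PS \<Longrightarrow> \<exists>\<Upsilon>. projective_change A \<Upsilon> \<Gamma> \<Gamma>'"
    using projective_structure_base assms(5) by blast
  interpret L: null_parallel_tractor A PS H I \<Gamma>
    using assms(3,6,7,9-12,14) \<Gamma> unfolding \<Phi> by unfold_locales
  have \<sigma>L: "\<sigma> = L.\<sigma>" and lamL: "lam = L.lam"
    unfolding \<sigma> lam L.\<sigma>_def[abs_def] L.lam_def[abs_def] L.dual_X_def \<Phi> X
    by (simp_all add: fun_eq_iff tractor_pairing_eq_inner tractor2_inverse_def canonical_tractor_def)
  have inZn: "p \<in> Zn \<longleftrightarrow> coord c p \<notin> L.proj_nonzero c" if "c \<in> A" "p \<in> chart_dom c" for c p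
    using L.zero_locus_projection[OF that] L.coord_in_image[OF that(2)]
    unfolding Zn nn L.proj_nonzero_def by auto
  \<comment> \<open>All five conditions are unchanged by division by a positive number, so one chart
    and the scale \<open>\<Gamma>\<close> decide them.\<close>
  have in\<O>: "p \<in> \<O> \<longleftrightarrow> L.\<sigma> \<Gamma> c (coord c p) \<noteq> 0"
    and in\<sigma>: "p \<in> zero_locus A PS \<sigma> \<longleftrightarrow> L.\<sigma> \<Gamma> c (coord c p) = 0"
    and inneg: "p \<in> points_where A PS lam (\<lambda>v. v < 0) \<longleftrightarrow> L.lam \<Gamma> c (coord c p) < 0"
    and inpos: "p \<in> points_where A PS lam (\<lambda>v. v > 0) \<longleftrightarrow> L.lam \<Gamma> c (coord c p) > 0"
    and inzero: "p \<in> zero_locus A PS lam \<longleftrightarrow> L.lam \<Gamma> c (coord c p) = 0"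
    if "c \<in> A" "p \<in> chart_dom c" for c p
    unfolding \<O> zero_locus_def \<sigma>L lamL
    by (rule L.points_where_\<sigma>[OF that] L.points_where_lam[OF that],
        simp add: divide_less_0_iff zero_less_divide_iff)+
  have Zn_imp: "L.\<sigma> \<Gamma> c (coord c p) = 0" "L.lam \<Gamma> c (coord c p) = 0"
    if "c \<in> A" "p \<in> chart_dom c" "p \<in> Zn" for c p
    using L.zero_of_projection_imp[OF that(1,2)] L.zero_locus_projection[OF that(1,2)] that(3)
    unfolding Zn nn by auto
  note mem = in\<O> in\<sigma> inneg inpos inzero
  \<comment> \<open>Chart-free facts: trichotomy for \<lambda> and the inclusion of
    \<open>Zn\<close> in both zero sets. The decompositions follow from them by set algebra.\<close>
  have memZ: "p \<in> Zn \<Longrightarrow> p \<in> zero_locus A PS \<sigma> \<and> p \<in> zero_locus A PS lam"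
    and mem\<O>: "p \<in> \<O> \<longleftrightarrow> p \<notin> zero_locus A PS \<sigma>"
    and memneg: "p \<in> points_where A PS lam (\<lambda>v. v < 0) \<Longrightarrow>
      p \<notin> zero_locus A PS lam \<and> p \<notin> points_where A PS lam (\<lambda>v. v > 0)"
    and mempos: "p \<in> points_where A PS lam (\<lambda>v. v > 0) \<Longrightarrow> p \<notin> zero_locus A PS lam"
    and memex: "p \<notin> points_where A PS lam (\<lambda>v. v < 0) \<Longrightarrow> p \<notin> points_where A PS lam (\<lambda>v. v > 0) \<Longrightarrow>
      p \<in> zero_locus A PS lam" for p
  proof -
    obtain c where c: "c \<in> A" "p \<in> chart_dom c" by (rule L.chart_at)
    show "p \<in> Zn \<Longrightarrow> p \<in> zero_locus A PS \<sigma> \<and> p \<in> zero_locus A PS lam"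
      using mem[OF c] Zn_imp[OF c] by simp
    show "p \<in> \<O> \<longleftrightarrow> p \<notin> zero_locus A PS \<sigma>"
      using mem[OF c] by simp
    show "p \<in> points_where A PS lam (\<lambda>v. v < 0) \<Longrightarrow>
      p \<notin> zero_locus A PS lam \<and> p \<notin> points_where A PS lam (\<lambda>v. v > 0)"
      using mem[OF c] by simp
    show "p \<in> points_where A PS lam (\<lambda>v. v > 0) \<Longrightarrow> p \<notin> zero_locus A PS lam"
      using mem[OF c] by simp
    show "p \<notin> points_where A PS lam (\<lambda>v. v < 0) \<Longrightarrow> p \<notin> points_where A PS lam (\<lambda>v. v > 0) \<Longrightarrow>
      p \<in> zero_locus A PS lam"
      using mem[OF c] by simp
  qed
  have decomp: "disjoint_decomposition UNIV [M, Zn]" "disjoint_decomposition M [\<O>, \<Sigma>]"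
    "disjoint_decomposition \<Sigma> [\<Sigma>neg, \<Sigma>zero, \<Sigma>pos]"
    "disjoint_decomposition UNIV [\<O>, \<Sigma>neg, \<Sigma>zero, \<Sigma>pos, Zn]"
    unfolding disjoint_decomposition_Cons M \<Sigma> \<Sigma>neg \<Sigma>zero \<Sigma>pos
    using memZ mem\<O> memneg mempos memex
    by (auto simp: disjoint_decomposition_def)
  \<comment> \<open>\<open>Zn\<close> is closed in a compact space, hence compact; being also
    discrete, it is finite.\<close>
  have "open (- Zn)"
    using inZn by (intro L.open_by_charts[OF L.open_proj_nonzero]) simp_all
  then have "compact Zn"
    using compact_Int_closed[OF assms(4), of Zn] by (simp add: closed_def)
  moreover have isolated: "\<forall>p\<in>Zn. p isolated_in Zn"
    using L.isolated_in_zero_locus_projection unfolding Zn nn by blast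
  ultimately have "finite Zn"
    using discrete_compact_finite_iff unfolding discrete_def by blast
  have open_pre: "open {x \<in> chart_image c. P (f x)}"
    if "c \<in> A" "smooth_on (chart_image c) f" "open {v. P v}" for c P and f :: "real^'m \<Rightarrow> real"
  proof -
    have "open (chart_image c \<inter> f -` {v. P v})"
      using continuous_open_preimage[OF smooth_on_continuous[OF that(2)] L.open_image[OF that(1)] that(3)] .
    then show ?thesis by (simp add: Int_def vimage_def)
  qed
  have "open \<O>"
  proof (rule L.open_by_charts)
    show "open {x \<in> chart_image c. L.\<sigma> \<Gamma> c x \<noteq> 0}" if "c \<in> A" for c
      by (rule open_pre[OF that L.smooth_\<sigma>[OF that]]) (simp add: open_Collect_neq)
    show "p \<in> \<O> \<longleftrightarrow> coord c p \<in> {x \<in> chart_image c. L.\<sigma> \<Gamma> c x \<noteq> 0}"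
      if "c \<in> A" "p \<in> chart_dom c" for c p
      using in\<O>[OF that] L.coord_in_image[OF that(2)] by simp
  qed
  have \<Sigma>_emb: "embedded_hypersurface A \<Sigma>"
    unfolding embedded_hypersurface_def
    by (rule L.embedded_in_zero_locus_\<sigma>[OF L.open_proj_nonzero])
      (simp_all add: \<Sigma> inZn in\<sigma> L.proj_nonzero_sub)
  \<comment> \<open>A strict sign of \<lambda> already excludes \<open>Zn\<close>, where \<lambda>
    vanishes, so it alone serves as the open condition here and for
    \<open>\<Sigma>pos\<close>.\<close>
  have "embedded_submanifold A (CARD('m) - 1) \<Sigma>neg"
  proof (rule L.embedded_in_zero_locus_\<sigma>)
    show "open {x \<in> chart_image c. L.lam \<Gamma> c x < 0}" if "c \<in> A" for c
      by (rule open_pre[OF that L.smooth_lam[OF that]]) (simp add: open_Collect_less)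
  qed (simp_all add: \<Sigma>neg in\<sigma> inneg L.coord_in_image subset_iff)
  moreover have "embedded_submanifold A (CARD('m) - 1) \<Sigma>pos"
  proof (rule L.embedded_in_zero_locus_\<sigma>)
    show "open {x \<in> chart_image c. L.lam \<Gamma> c x > 0}" if "c \<in> A" for c
      by (rule open_pre[OF that L.smooth_lam[OF that]]) (simp add: open_Collect_less)
  qed (simp_all add: \<Sigma>pos in\<sigma> inpos L.coord_in_image subset_iff)
  moreover have "embedded_submanifold A (CARD('m) - 2) \<Sigma>zero"
    by (rule L.embedded_zero_locus_\<sigma>_lam) (simp add: \<Sigma>zero in\<sigma> inzero inZn)
  ultimately show ?thesis
    using decomp isolated \<open>finite Zn\<close> \<open>open \<O>\<close> \<Sigma>_emb unfolding smooth_submanifold_def by blast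
qed

end
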